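(* Let $n\ge2$, $m\ge2$ be integers with $m\ge\sqrt n$, let $B_1,\ldots,B_m$ be mutually unbiased orthonormal bases of $\mathbb{C}^n$, and let $\mathfrak{B}=\bigsqcup_{i=1}^m B_i$. Let $p$ be a positive integer with $y=\frac pn\in(0,1)$. Let $\Omega_p$ be the set of all maps $s:\{1,\ldots,p\}\to\mathfrak{B}$ with the uniform probability, and for $s\in\Omega_p$ let $\mathcal{G}(s)$ be the $p\times p$ matrix with $(i,j)$-entry $\langle s(i),s(j)\rangle$. For a positive integer $l$ set $A_l(s)=\frac1p\mathrm{Tr}\big(\mathcal{G}(s)^l\big)$. Then for every fixed positive integer $l$, $$\mathrm{Var}\big(A_l(s),\Omega_p\big)=O_l\!\left(\frac{1}{mn}+\frac1{n^2}\right),$$ where the implied constant depends only on $l$.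
   Context: Orthonormal bases $B_1,\ldots,B_m$ of $\mathbb{C}^n$ are mutually unbiased if $|\langle u,v\rangle|=\frac{1}{\sqrt n}$ for all $u\in B_i$, $v\in B_j$, $i\ne j$, where $\langle\cdot,\cdot\rangle$ is the standard Hermitian inner product. $\mathrm{Var}(X,\Omega_p)=\mathbb{E}(|X|^2,\Omega_p)-|\mathbb{E}(X,\Omega_p)|^2$, with expectation taken with respect to the uniform probability on $\Omega_p$. *)

theory Defs
  imports Complex_Main "Jordan_Normal_Form.Matrix"
begin

text \<open>Vectors of C^n are represented as functions nat => complex; only the
coordinates 0..n-1 matter. Standard Hermitian inner product.\<close>
definition herm_inner :: "nat \<Rightarrow> (nat \<Rightarrow> complex) \<Rightarrow> (nat \<Rightarrow> complex) \<Rightarrow> complex" where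
  "herm_inner n u v = (\<Sum>k<n. u k * cnj (v k))"

text \<open>A family of m orthonormal bases of C^n: b i k is the k-th vector of
the i-th basis (i < m, k < n).\<close>
definition orthonormal_bases :: "nat \<Rightarrow> nat \<Rightarrow> (nat \<Rightarrow> nat \<Rightarrow> nat \<Rightarrow> complex) \<Rightarrow> bool" where
  "orthonormal_bases n m b \<longleftrightarrow>
     (\<forall>i<m. \<forall>k<n. \<forall>k'<n. herm_inner n (b i k) (b i k') = (if k = k' then 1 else 0))"

definition mutually_unbiased :: "nat \<Rightarrow> nat \<Rightarrow> (nat \<Rightarrow> nat \<Rightarrow> nat \<Rightarrow> complex) \<Rightarrow> bool" where
  "mutually_unbiased n m b \<longleftrightarrow> orthonormal_bases n m b \<and>
     (\<forall>i<m. \<forall>j<m. i \<noteq> j \<longrightarrow>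
        (\<forall>k<n. \<forall>k'<n. cmod (herm_inner n (b i k) (b j k')) = 1 / sqrt n))"

text \<open>The disjoint union of the bases, as labelled indices (i,k).\<close>
definition frakB :: "nat \<Rightarrow> nat \<Rightarrow> (nat \<times> nat) set" where
  "frakB n m = {..<m} \<times> {..<n}"

definition Omega :: "nat \<Rightarrow> nat \<Rightarrow> nat \<Rightarrow> (nat \<Rightarrow> nat \<times> nat) set" where
  "Omega n m p = PiE {..<p} (\<lambda>_. frakB n m)"

definition gram :: "nat \<Rightarrow> (nat \<Rightarrow> nat \<Rightarrow> nat \<Rightarrow> complex) \<Rightarrow> nat \<Rightarrow> (nat \<Rightarrow> nat \<times> nat) \<Rightarrow> complex mat" where
  "gram n b p s = mat p p (\<lambda>(i, j). herm_inner n (case s i of (a, k) \<Rightarrow> b a k) (case s j of (a, k) \<Rightarrow> b a k))"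

definition mat_trace :: "complex mat \<Rightarrow> complex" where
  "mat_trace A = (\<Sum>i<dim_row A. A $$ (i, i))"

definition A_l :: "nat \<Rightarrow> (nat \<Rightarrow> nat \<Rightarrow> nat \<Rightarrow> complex) \<Rightarrow> nat \<Rightarrow> nat \<Rightarrow> (nat \<Rightarrow> nat \<times> nat) \<Rightarrow> complex" where
  "A_l n b p l s = mat_trace (gram n b p s ^\<^sub>m l) / of_nat p"

definition unif_expect :: "'a set \<Rightarrow> ('a \<Rightarrow> complex) \<Rightarrow> complex" where
  "unif_expect \<Omega> X = (\<Sum>s\<in>\<Omega>. X s) / of_nat (card \<Omega>)"

definition unif_var :: "'a set \<Rightarrow> ('a \<Rightarrow> complex) \<Rightarrow> real" where
  "unif_var \<Omega> X = Re (unif_expect \<Omega> (\<lambda>s. of_real ((cmod (X s))\<^sup>2))) - (cmod (unif_expect \<Omega> X))\<^sup>2"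

end

theory Submission
  imports Defs "HOL-Library.Sublist" "Jordan_Normal_Form.Determinant"
begin

text \<open>
  Expanding the trace of \<open>G^l\<close> gives a sum over words \<open>w\<close> of length \<open>l\<close>
  in the indices \<open>0, \<dots>, p - 1\<close> of the cyclic products
  \<open>T\<^sub>w(s) = \<Prod>\<langle>s(w\<^sub>t), s(w\<^bsub>t+1\<^esub>)\<rangle>\<close>. Let \<open>V\<close> be the number
  of distinct letters of \<open>w\<close>, and let \<open>N = m n\<close>. Then
  \<open>n^V E T\<^sub>w = n + O(1 + n\<^sup>2 / N)\<close> if the partition of the cycle given by \<open>w\<close>
  is noncrossing, and \<open>n^V E T\<^sub>w = O(1 + n\<^sup>2 / N)\<close> otherwise. Indeed equal adjacent letters
  may be merged, and a letter that occurs once is averaged out at the price of \<open>1 / n\<close>, because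
  the vectors form a tight frame. A word that allows neither step is crossing, and its mean is
  bounded in absolute value, sorting the assignments \<open>s\<close> by the number \<open>k\<close> of values: if
  \<open>k \<ge> 2\<close>, then at least \<open>3 k - V\<close> factors have modulus at most \<open>n^(-1/2)\<close>,
  while the proportion of such \<open>s\<close> is \<open>O(N^(k - V))\<close> with
  \<open>N \<ge> n^(3/2)\<close>.

  The product of two cyclic products with a common letter is again a cyclic product, so that the
  main terms of \<open>Cov(T\<^sub>w, T\<^bsub>w'\<^esub>)\<close> cancel. Words without a common letter are independent,
  and there are \<open>O(p^k)\<close> pairs of words with \<open>k\<close> letters altogether.
\<close>

section \<open>Cyclic products and crossing words\<close>

definition cyclic_prod :: "('a \<Rightarrow> 'a \<Rightarrow> complex) \<Rightarrow> 'a list \<Rightarrow> complex" where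
  "cyclic_prod H xs = (\<Prod>(x, y)\<leftarrow>zip xs (rotate1 xs). H x y)"

text \<open>Open walks with explicit end points can be cut at any interior vertex; rotation, joining
  and averaging of closed walks are all derived from such cuts.\<close>

definition path_prod :: "('a \<Rightarrow> 'a \<Rightarrow> complex) \<Rightarrow> 'a \<Rightarrow> 'a list \<Rightarrow> 'a \<Rightarrow> complex" where
  "path_prod H x zs y = (\<Prod>(u, v)\<leftarrow>zip (x # zs) (zs @ [y]). H u v)"

lemma cyclic_prod_Cons: "cyclic_prod H (x # xs) = path_prod H x xs x"
  by (simp add: cyclic_prod_def path_prod_def)

lemma path_prod_Nil [simp]: "path_prod H x [] y = H x y"
  by (simp add: path_prod_def)

lemma path_prod_append:
  "path_prod H x (us @ z # vs) y = path_prod H x us z * path_prod H z vs y"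
proof -
  have "zip (x # us @ z # vs) ((us @ z # vs) @ [y])
        = zip ((x # us) @ (z # vs)) ((us @ [z]) @ (vs @ [y]))" by simp
  also have "\<dots> = zip (x # us) (us @ [z]) @ zip (z # vs) (vs @ [y])"
    by (subst zip_append) simp_all
  finally show ?thesis by (simp add: path_prod_def del: zip_Cons_Cons append_Cons)
qed

lemma path_prod_Cons: "path_prod H x (z # vs) y = H x z * path_prod H z vs y"
  using path_prod_append[of H x "[]" z vs y] by simp

text \<open>Both closed walks are based at \<open>v\<close>, so one can be run after the other. This
  turns a second moment of walks into a first moment.\<close>

lemma cyclic_prod_join:
  "cyclic_prod H (v # us @ v # vs) = cyclic_prod H (v # us) * cyclic_prod H (v # vs)"
  by (simp add: cyclic_prod_Cons path_prod_append)

lemma cyclic_prod_rotate1: "cyclic_prod H (rotate1 xs) = cyclic_prod H xs"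
proof (cases xs)
  case (Cons x ys)
  then show ?thesis
    by (cases ys) (simp_all add: cyclic_prod_Cons path_prod_Cons path_prod_append)
qed (simp add: cyclic_prod_def)

lemma cyclic_prod_rotate: "cyclic_prod H (rotate k xs) = cyclic_prod H xs"
  by (induction k) (simp_all add: cyclic_prod_rotate1)

lemma path_prod_cnj:
  assumes "\<And>x y. H y x = cnj (H x y)"
  shows "cnj (path_prod H x zs y) = path_prod H y (rev zs) x"
proof (induction zs arbitrary: x)
  case Nil
  then show ?case by (simp add: assms[of x y])
next
  case (Cons z zs)
  then show ?case by (simp add: path_prod_Cons path_prod_append assms[of x z])
qed

text \<open>Conjugating a Hermitian kernel reverses every step, so the walk is run backwards. This
  removes the conjugates from second moments.\<close>

lemma cyclic_prod_cnj:
  assumes "\<And>x y. H y x = cnj (H x y)"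
  shows "cnj (cyclic_prod H xs) = cyclic_prod H (rev xs)"
proof (cases xs)
  case (Cons x ys)
  have "cyclic_prod H (rev xs) = cyclic_prod H (rotate (length ys) (rev xs))"
    by (simp add: cyclic_prod_rotate)
  also have "rotate (length ys) (rev xs) = x # rev ys"
    using rotate_append[of "rev ys" "[x]"] Cons by simp
  finally show ?thesis
    using Cons path_prod_cnj[of H x ys x, OF assms] by (simp add: cyclic_prod_Cons)
qed (simp add: cyclic_prod_def)

lemma cyclic_prod_nth:
  "cyclic_prod H xs = (\<Prod>t<length xs. H (xs ! t) (xs ! (Suc t mod length xs)))"
proof -
  have "cyclic_prod H xs = (\<Prod>t<length (zip xs (rotate1 xs)). 
     (\<lambda>(x, y). H x y) (zip xs (rotate1 xs) ! t))"
    unfolding cyclic_prod_def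
    by (subst prod.list_conv_set_nth) (simp add: atLeast0LessThan)
  also have "\<dots> = (\<Prod>t<length xs. H (xs ! t) (xs ! (Suc t mod length xs)))"
    by (intro prod.cong) (auto simp: nth_rotate1)
  finally show ?thesis .
qed

section \<open>Crossing words and their behaviour under rotation and reduction\<close>

lemma subseq_imp_set_subset: "subseq xs ys \<Longrightarrow> set xs \<subseteq> set ys"
  by (auto elim: list_emb_set)

text \<open>A word stands for the partition of its positions into classes of equal letters; the
  pattern \<open>x y x y\<close> is the usual obstruction to a noncrossing partition.\<close>

definition crossing :: "'a list \<Rightarrow> bool" where
  "crossing w \<longleftrightarrow> (\<exists>x y. x \<noteq> y \<and> subseq [x, y, x, y] w)"

lemma crossing_mono: "crossing u \<Longrightarrow> subseq u w \<Longrightarrow> crossing w"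
  unfolding crossing_def using subseq_order.order_trans by blast

text \<open>If the pattern begins at the letter that is moved, then \<open>x y x y\<close> becomes
  \<open>y x y x\<close>, which is the same pattern with the roles exchanged.\<close>

lemma crossing_rotate1_imp: "crossing w \<Longrightarrow> crossing (rotate1 w)"
proof (cases w)
  case (Cons a u)
  assume "crossing w"
  then obtain x y where xy: "x \<noteq> y" "subseq [x, y, x, y] (a # u)"
    unfolding crossing_def Cons by blast
  show ?thesis
  proof (cases "x = a")
    case True
    with xy have "subseq [y, x, y] u" by simp
    then have "subseq ([y, x, y] @ [x]) (u @ [a])"
      using True by (intro list_emb_append_mono) auto
    then show ?thesis
      using xy(1) Cons unfolding crossing_def by (intro exI[of _ y] exI[of _ x]) simp
  next
    case False
    with xy have "subseq [x, y, x, y] u" by simp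
    then have "crossing u" using xy unfolding crossing_def by blast
    then show ?thesis using Cons by (auto elim: crossing_mono)
  qed
qed simp

lemma crossing_rotate: "crossing (rotate k w) \<longleftrightarrow> crossing w"
proof -
  have imp: "crossing u \<Longrightarrow> crossing (rotate j u)" for j and u :: "'a list"
    by (induction j) (simp_all add: crossing_rotate1_imp)
  obtain j where "rotate j (rotate k w) = w"
  proof (cases "w = []")
    case False
    \<comment> \<open>Rotating on to a multiple of \<open>length w\<close> undoes the first
      \<open>k\<close> rotations; the factor \<open>Suc k\<close> keeps the subtraction from
      truncating.\<close>
    have "rotate (length w * Suc k - k) (rotate k w) = rotate (length w * Suc k) w"
    proof -
      have "k \<le> length w * Suc k" using False by (cases w) auto
      then show ?thesis by (simp add: rotate_rotate)
    qed
    also have "\<dots> = w" by (metis rotate_id mod_mult_self1_is_0)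
    finally show ?thesis by (rule that)
  qed (simp add: that)
  then show ?thesis using imp[of "rotate k w" j] imp[of w k] by auto
qed

text \<open>The pattern alternates between distinct letters, so it never needs both copies of
  \<open>x\<close> at the front.\<close>

lemma crossing_adjacent: "crossing (x # x # u) \<longleftrightarrow> crossing (x # u)"
proof
  assume "crossing (x # x # u)"
  then obtain a b where ab: "a \<noteq> b" "subseq [a, b, a, b] (x # x # u)"
    unfolding crossing_def by blast
  then have "subseq [a, b, a, b] (x # u)"
    by (cases "a = x") auto
  then show "crossing (x # u)" using ab unfolding crossing_def by blast
qed (auto elim: crossing_mono)

text \<open>Each letter of the pattern is used twice, so a letter that occurs once cannot take part
  in it.\<close>

lemma crossing_singleton:
  assumes "x \<notin> set u"
  shows "crossing (x # u) \<longleftrightarrow> crossing u"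
proof
  assume "crossing (x # u)"
  then obtain a b where ab: "a \<noteq> b" "subseq [a, b, a, b] (x # u)"
    unfolding crossing_def by blast
  have "a \<noteq> x"
  proof
    assume "a = x"
    with ab have "subseq [b, a, b] u" by simp
    then show False using assms \<open>a = x\<close> by (auto dest: subseq_imp_set_subset)
  qed
  then show "crossing u" using ab unfolding crossing_def by auto
qed (auto elim: crossing_mono)

lemma not_crossing_Cons_Nil: "\<not> crossing [x]"
  by (auto simp: crossing_def split: if_splits)

section \<open>Cyclically reduced words\<close>

lemma subseq_nth_Cons_drop:
  assumes "k \<le> a" "a < length w" "subseq ys (drop (Suc a) w)"
  shows "subseq (w ! a # ys) (drop k w)"
proof -
  have "subseq (w ! a # ys) (drop a w)"
    using assms by (simp flip: Cons_nth_drop_Suc)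
  moreover have "drop a w = drop (a - k) (drop k w)" using assms by simp
  moreover have "subseq (drop (a - k) (drop k w)) (drop k w)"
    by (metis append_take_drop_id list_emb_append2 subseq_order.order_refl)
  ultimately show ?thesis using subseq_order.order_trans by metis
qed

lemma crossing_nthI:
  assumes "a < b" "b < c" "c < d" "d < length w" "w ! a = w ! c" "w ! b = w ! d" "w ! a \<noteq> w ! b"
  shows "crossing w"
proof -
  have "subseq [w ! a, w ! b, w ! c, w ! d] (drop 0 w)"
    using assms(1-4) by (intro subseq_nth_Cons_drop) auto
  then show ?thesis using assms unfolding crossing_def
    by (intro exI[of _ "w ! a"] exI[of _ "w ! b"]) simp
qed

text \<open>These are the words to which neither reduction applies: merging equal cyclic neighbours,
  or averaging out a letter that occurs once. A word of length one is its own neighbour and hence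
  not reduced, while the empty word is reduced vacuously.\<close>

definition cyclically_reduced :: "'a list \<Rightarrow> bool" where
  "cyclically_reduced w \<longleftrightarrow>
     (\<forall>t<length w. w ! t \<noteq> w ! (Suc t mod length w)) \<and>
     (\<forall>t<length w. \<exists>t'<length w. t' \<noteq> t \<and> w ! t' = w ! t)"

text \<open>Take two occurrences of the same letter at minimal distance: a letter strictly
between them must recur outside.\<close>
lemma cyclically_reduced_imp_crossing:
  assumes "cyclically_reduced w" "w \<noteq> []"
  shows "crossing w"
proof -
  define P where "P d \<longleftrightarrow> (\<exists>a. d > 0 \<and> a + d < length w \<and> w ! a = w ! (a + d))" for d
  have rep: "\<exists>t'<length w. t' \<noteq> t \<and> w ! t' = w ! t" if "t < length w" for t
    using assms that unfolding cyclically_reduced_def by blast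
  have Pdist: "P (c - a)" if "a < c" "c < length w" "w ! a = w ! c" for a c
    unfolding P_def using that by (intro exI[of _ a]) auto
  obtain t' where "t' < length w" "t' \<noteq> 0" "w ! t' = w ! 0"
    using rep[of 0] assms(2) by auto
  then have "P t'" using Pdist[of 0 t'] by simp
  then have PL: "P (LEAST d. P d)" by (rule LeastI)
  define d where "d = Least P"
  have minimal: "d \<le> e" if "P e" for e unfolding d_def using that by (rule Least_le)
  obtain a where a: "d > 0" "a + d < length w" "w ! a = w ! (a + d)"
    using PL P_def[of d] unfolding d_def by blast
  have adj: "w ! a \<noteq> w ! Suc a"
    using assms(1) a unfolding cyclically_reduced_def
    by (metis Suc_leI add_lessD1 less_add_same_cancel1 mod_less order_le_less_trans)
  then have "d \<noteq> 1" using a by auto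
  obtain t where t: "t < length w" "t \<noteq> Suc a" "w ! t = w ! Suc a"
    using rep[of "Suc a"] a by auto
  have "t \<noteq> a" "t \<noteq> a + d" using t adj a by auto
  consider "t < a" | "a + d < t" | "Suc a < t" "t < a + d"
    using \<open>t \<noteq> a\<close> \<open>t \<noteq> a + d\<close> t(2) by linarith
  then show ?thesis
  proof cases
    case 1
    then show ?thesis
      using crossing_nthI[of t a "Suc a" "a + d" w] t a adj \<open>d \<noteq> 1\<close> by auto
  next
    case 2
    then show ?thesis
      using crossing_nthI[of a "Suc a" "a + d" t w] t a adj \<open>d \<noteq> 1\<close> by auto
  next
    case 3
    then have "P (t - Suc a)" using Pdist[of "Suc a" t] t by simp
    then show ?thesis using minimal 3 by fastforce
  qed
qed

text \<open>Rotation brings the offending position to the front, so that both reductions act at the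
  head of a list. Crossing and walk means are invariant under rotation.\<close>

lemma not_cyclically_reduced_cases:
  assumes "\<not> cyclically_reduced w" "length w \<ge> 2"
  obtains (adjacent) k x u where "rotate k w = x # x # u"
    | (singleton) k x u where "rotate k w = x # u" "x \<notin> set u"
proof -
  consider t where "t < length w" "w ! t = w ! (Suc t mod length w)"
    | t where "t < length w" "\<And>t'. t' < length w \<Longrightarrow> t' \<noteq> t \<Longrightarrow> w ! t' \<noteq> w ! t"
    using assms(1) unfolding cyclically_reduced_def by blast
  then show ?thesis
  proof cases
    case 1
    have "rotate t w ! 0 = w ! (t mod length w)" "rotate t w ! 1 = w ! (Suc t mod length w)"
      using assms(2) nth_rotate[of 0 w t] nth_rotate[of 1 w t] by fastforce+
    then have "rotate t w ! 0 = w ! t" "rotate t w ! 1 = w ! t"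
      using 1 by simp_all
    moreover have "length (rotate t w) \<ge> 2" using assms(2) by simp
    ultimately obtain u where "rotate t w = w ! t # w ! t # u"
      by (cases "rotate t w"; cases "tl (rotate t w)") auto
    then show ?thesis by (rule adjacent)
  next
    case 2
    have eq: "rotate t w = w ! t # (drop (Suc t) w @ take t w)"
      using 2(1) by (simp add: rotate_drop_take Cons_nth_drop_Suc)
    have "w ! t \<notin> set (drop (Suc t) w @ take t w)"
    proof
      assume "w ! t \<in> set (drop (Suc t) w @ take t w)"
      then consider j where "j < length (drop (Suc t) w)" "drop (Suc t) w ! j = w ! t"
        | j where "j < length (take t w)" "take t w ! j = w ! t"
        by (auto simp: in_set_conv_nth simp del: length_drop length_take)
      then show False
      proof cases
        case 1
        then have "Suc t + j < length w" by simp
        then show False using 1(2) 2 by (metis add_Suc less_add_Suc1 less_irrefl nth_drop Suc_leI)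
      next
        case (2 j)
        then show False using \<open>\<And>t'. t' < length w \<Longrightarrow> t' \<noteq> t \<Longrightarrow> w ! t' \<noteq> w ! t\<close>[of j] by auto
      qed
    qed
    then show ?thesis using eq by (rule singleton[rotated])
  qed
qed

section \<open>Crossings in the join of two closed walks\<close>

lemma crossing_joinD:
  assumes c: "crossing (v # us @ v # vs)" and disj: "set (v # us) \<inter> set (v # vs) = {v}"
  shows "crossing (v # us) \<or> crossing (v # vs)"
proof -
  obtain x y where xy: "x \<noteq> y" "subseq [x, y, x, y] ((v # us) @ (v # vs))"
    using c unfolding crossing_def by auto
  have right: "subseq zs r" if "subseq zs (l @ r)" "zs \<noteq> [] \<longrightarrow> hd zs \<notin> set l" for zs l r :: "'a list"
  proof -
    obtain p q where pq: "zs = p @ q" "subseq p l" "subseq q r"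
      using \<open>subseq zs (l @ r)\<close> by (rule subseq_appendE)
    have "p = []"
    proof (rule ccontr)
      assume "p \<noteq> []"
      then have "hd p \<in> set l" using subseq_imp_set_subset[OF pq(2)] by auto
      then show False using that(2) pq(1) \<open>p \<noteq> []\<close> by simp
    qed
    then show ?thesis using pq by simp
  qed
  have left: "subseq zs l" if "subseq zs (l @ r)" "zs \<noteq> [] \<longrightarrow> last zs \<notin> set r" for zs l r :: "'a list"
  proof -
    obtain p q where pq: "zs = p @ q" "subseq p l" "subseq q r"
      using \<open>subseq zs (l @ r)\<close> by (rule subseq_appendE)
    have "q = []"
    proof (rule ccontr)
      assume "q \<noteq> []"
      then have "last q \<in> set r" using subseq_imp_set_subset[OF pq(3)] by auto
      then show False using that(2) pq(1) \<open>q \<noteq> []\<close> by simp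
    qed
    then show ?thesis using pq by simp
  qed
  let ?l = "v # us" and ?r = "v # vs"
  have tl: "subseq [y, x, y] (?l @ ?r)"
    using xy(2) by (rule subseq_Cons')
  have init: "subseq [x, y, x] (?l @ ?r)"
    using xy(2) by (rule subseq_order.order_trans[rotated]) simp
  \<comment> \<open>A letter other than \<open>v\<close> lies in one half only and pulls the
    adjacent part of the pattern into that half. If one end of the pattern is lost, its letter is
    \<open>v\<close>, and the head of the half supplies it.\<close>
  consider (a) "y \<notin> set ?r" | (b) "y \<in> set ?r" "y \<noteq> v" | (c) "y = v" by auto
  then show ?thesis
  proof cases
    case a
    then have "subseq [x, y, x, y] ?l" by (intro left[OF xy(2)]) simp
    then show ?thesis using xy(1) unfolding crossing_def by blast
  next
    case b
    then have "y \<notin> set ?l" using disj by blast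
    then have r3: "subseq [y, x, y] ?r" by (intro right[OF tl]) simp
    show ?thesis
    proof (cases "x = v")
      case True
      \<comment> \<open>The leading \<open>x = v\<close> may come from the left half; the head of
        the right half replaces it.\<close>
      then have "subseq [x, y, x, y] ?r" using r3 b by simp
      then show ?thesis using xy(1) unfolding crossing_def by blast
    next
      case False
      have "x \<in> set ?r" using subseq_imp_set_subset[OF r3] by simp
      then have "x \<notin> set ?l" using False disj by blast
      then have "subseq [x, y, x, y] ?r" by (intro right[OF xy(2)]) simp
      then show ?thesis using xy(1) unfolding crossing_def by blast
    qed
  next
    case c
    show ?thesis
    proof (cases "x \<in> set ?l")
      case True
      then have "x \<notin> set ?r" using disj xy(1) c by blast
      then have "subseq [x, y, x] ?l" by (intro left[OF init]) simp
      \<comment> \<open>The final \<open>y = v\<close> is given up, and the head of the left half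
        supplies a \<open>y\<close> in front instead.\<close>
      then have "subseq [y, x, y, x] ?l" using c xy(1) by simp
      then show ?thesis using xy(1) unfolding crossing_def by metis
    next
      case False
      then have "subseq [x, y, x, y] ?r" by (intro right[OF xy(2)]) simp
      then show ?thesis using xy(1) unfolding crossing_def by blast
    qed
  qed
qed

lemma crossing_join_iff:
  assumes "set (v # us) \<inter> set (v # vs) = {v}"
  shows "crossing (v # us @ v # vs) \<longleftrightarrow> crossing (v # us) \<or> crossing (v # vs)"
proof -
  have "subseq (v # us) ((v # us) @ (v # vs))" "subseq (v # vs) ((v # us) @ (v # vs))" by auto
  then show ?thesis using crossing_joinD[OF _ assms] by (auto elim: crossing_mono)
qed

text \<open>Two common letters already give the pattern \<open>v u v u\<close>, so in this case the
  joined walk has no main term.\<close>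

lemma crossing_join_shared:
  assumes "u \<noteq> v" "u \<in> set us" "u \<in> set vs"
  shows "crossing (v # us @ v # vs)"
proof -
  have "subseq ([v, u] @ [v, u]) ((v # us) @ (v # vs))"
    using assms by (intro list_emb_append_mono) (simp_all add: subseq_singleton_left)
  then show ?thesis
    using assms(1) unfolding crossing_def by (intro exI[of _ v] exI[of _ u]) simp
qed

section \<open>Means over product sets\<close>

lemma card_lists_few_values:
  fixes B :: "'b set"
  assumes "finite B"
  shows "card {xs. length xs = L \<and> set xs \<subseteq> B \<and> card (set xs) = k} \<le> k ^ L * card B ^ k"
proof -
  let ?S = "{xs. length xs = L \<and> set xs \<subseteq> B \<and> card (set xs) = k}"
  let ?F = "{f. set f \<subseteq> {..<k} \<and> length f = L}"
  let ?Y = "{ys. set ys \<subseteq> B \<and> length ys = k}"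
  \<comment> \<open>A list with \<open>k\<close> values is recovered from the list \<open>ys\<close>
    of these values and, for each entry, its index in \<open>ys\<close>; this gives the two factors
    of the bound.\<close>
  have sub: "?S \<subseteq> (\<lambda>(f, ys). map ((!) ys) f) ` (?F \<times> ?Y)"
  proof
    fix xs assume xs: "xs \<in> ?S"
    define ys where "ys = remdups xs"
    have ys: "set ys = set xs" "length ys = k" "ys \<in> ?Y"
      using xs by (auto simp: ys_def length_remdups_card_conv)
    have "\<exists>i<k. ys ! i = x" if "x \<in> set xs" for x
      using that ys by (metis in_set_conv_nth)
    then obtain g where g: "\<And>x. x \<in> set xs \<Longrightarrow> g x < k \<and> ys ! (g x) = x" by metis
    then have "xs = map ((!) ys) (map g xs)" by (simp add: map_idI)
    moreover have "map g xs \<in> ?F" using g xs by auto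
    ultimately show "xs \<in> (\<lambda>(f, ys). map ((!) ys) f) ` (?F \<times> ?Y)"
      using ys(3) by (intro image_eqI[where x = "(map g xs, ys)"]) simp_all
  qed
  have fin: "finite (?F \<times> ?Y)"
    using assms by (intro finite_cartesian_product finite_lists_length_eq) auto
  have "card ?S \<le> card (?F \<times> ?Y)"
    using sub fin by (metis (no_types, lifting) card_image_le card_mono finite_imageI le_trans)
  also have "\<dots> = k ^ L * card B ^ k"
    using assms by (simp add: card_cartesian_product card_lists_length_eq)
  finally show ?thesis .
qed

lemma card_PiE_few_values:
  assumes "finite B" "finite X"
  shows "card {s \<in> PiE X (\<lambda>_. B). card (s ` X) = k} \<le> k ^ card X * card B ^ k"
proof -
  obtain xs where xs: "set xs = X" "distinct xs" using finite_distinct_list[OF assms(2)] by blast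
  have len: "length xs = card X" using xs distinct_card by fastforce
  let ?S = "{s \<in> PiE X (\<lambda>_. B). card (s ` X) = k}"
  let ?T = "{ys. length ys = card X \<and> set ys \<subseteq> B \<and> card (set ys) = k}"
  have "finite {ys. set ys \<subseteq> B \<and> length ys = card X}" by (rule finite_lists_length_eq[OF assms(1)])
  then have "finite ?T" by (rule rev_finite_subset) auto
  moreover have "inj_on (\<lambda>s. map s xs) ?S"
    by (intro inj_onI PiE_ext) (use xs in auto)
  moreover have "(\<lambda>s. map s xs) ` ?S \<subseteq> ?T" using xs len by auto
  ultimately have "card ?S \<le> card ?T" by (metis (no_types, lifting) card_inj_on_le)
  also have "\<dots> \<le> k ^ card X * card B ^ k" by (rule card_lists_few_values[OF assms(1)])
  finally show ?thesis .
qed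

section \<open>Means under independent uniform choices\<close>

definition product_mean :: "'b set \<Rightarrow> 'a set \<Rightarrow> (('a \<Rightarrow> 'b) \<Rightarrow> complex) \<Rightarrow> complex" where
  "product_mean B I F = (\<Sum>s\<in>PiE I (\<lambda>_. B). F s) / of_nat (card B) ^ card I"

definition depends_on :: "'a set \<Rightarrow> (('a \<Rightarrow> 'b) \<Rightarrow> complex) \<Rightarrow> bool" where
  "depends_on X F \<longleftrightarrow> (\<forall>s t. (\<forall>x\<in>X. s x = t x) \<longrightarrow> F s = F t)"

text \<open>This is the conditional mean over coordinate \<open>i\<close>, with all other
  coordinates held fixed.\<close>

definition resample :: "'b set \<Rightarrow> 'a \<Rightarrow> (('a \<Rightarrow> 'b) \<Rightarrow> complex) \<Rightarrow> ('a \<Rightarrow> 'b) \<Rightarrow> complex" where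
  "resample B i F s = (\<Sum>v\<in>B. F (s(i := v))) / of_nat (card B)"

lemma depends_onD: "depends_on X F \<Longrightarrow> (\<And>x. x \<in> X \<Longrightarrow> s x = t x) \<Longrightarrow> F s = F t"
  unfolding depends_on_def by blast

lemma depends_on_resample: "depends_on X F \<Longrightarrow> depends_on X (resample B i F)"
  unfolding depends_on_def resample_def by (auto intro!: sum.cong arg_cong2[where f = "(/)"])

context
  fixes B :: "'b set"
  assumes B: "finite B" "B \<noteq> {}"
begin

lemma card_B_nonzero: "of_nat (card B) \<noteq> (0 :: complex)"
  using B by simp

text \<open>Fubini for a single coordinate; it drives all inductions on the index set.\<close>

lemma product_mean_insert:
  fixes I :: "'a set"
  assumes "finite I" "i \<notin> I"
  shows "product_mean B (insert i I) F = product_mean B I (resample B i F)"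
proof -
  have "(\<Sum>s\<in>PiE (insert i I) (\<lambda>_. B). F s) = (\<Sum>(v, s)\<in>B \<times> PiE I (\<lambda>_. B). F (s(i := v)))"
    unfolding PiE_insert_eq
    by (subst sum.reindex) (use assms inj_combinator[of i I "\<lambda>_. B"] in \<open>auto simp: case_prod_unfold\<close>)
  also have "\<dots> = (\<Sum>s\<in>PiE I (\<lambda>_. B). \<Sum>v\<in>B. F (s(i := v)))"
    by (subst sum.swap, rule sum.cartesian_product[symmetric])
  finally show ?thesis
    unfolding product_mean_def resample_def
    using assms card_B_nonzero by (simp add: sum_divide_distrib field_simps)
qed

lemma resample_ignored:
  assumes "depends_on X F" "i \<notin> X"
  shows "resample B i F = F"
proof
  fix s
  have "F (s(i := v)) = F s" for v using assms by (intro depends_onD[OF assms(1)]) auto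
  then show "resample B i F s = F s" unfolding resample_def using card_B_nonzero by simp
qed

lemma product_mean_marginal:
  assumes "finite I" "X \<subseteq> I" "depends_on X F"
  shows "product_mean B I F = product_mean B X F"
proof -
  have "finite (I - X)" using assms by simp
  then have "product_mean B (X \<union> (I - X)) F = product_mean B X F"
    if "finite X" using that
  proof (induction "I - X" arbitrary: I rule: finite_induct)
    case empty
    then show ?case by (metis Un_empty_right)
  next
    case (insert i D)
    have i: "i \<notin> X" "i \<notin> D" using insert by auto
    have "D = (X \<union> D) - X" using insert by blast
    then have IH: "product_mean B (X \<union> D) F = product_mean B X F"
      using insert.hyps(3)[of "X \<union> D"] insert.prems by simp
    have "X \<union> (I - X) = insert i (X \<union> D)" using insert.hyps(4) by auto
    moreover have "product_mean B (insert i (X \<union> D)) F = product_mean B (X \<union> D) F"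
      using product_mean_insert[of "X \<union> D" i F] insert i resample_ignored[OF assms(3) i(1)] by simp
    ultimately show ?case using IH by simp
  qed
  moreover have "X \<union> (I - X) = I" using assms by blast
  ultimately show ?thesis using assms finite_subset by metis
qed

text \<open>Every coordinate is ignored by at least one of the two factors, so resampling it acts on
  the other factor alone. The induction generalizes \<open>F\<close> and \<open>G\<close> because
  resampling changes them.\<close>

lemma product_mean_indep:
  assumes "finite I" "X \<inter> Y = {}" "depends_on X F" "depends_on Y G"
  shows "product_mean B I (\<lambda>s. F s * G s) = product_mean B I F * product_mean B I G"
  using assms(1,3,4)
proof (induction I arbitrary: F G rule: finite_induct)
  case empty
  then show ?case by (simp add: product_mean_def)
next
  case (insert i I)
  have rF: "resample B i (\<lambda>s. F s * G s) = (\<lambda>s. F s * resample B i G s)" if "i \<notin> X"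
  proof
    fix s
    have "F (s(i := v)) = F s" for v using that by (intro depends_onD[OF insert.prems(1)]) auto
    then show "resample B i (\<lambda>s. F s * G s) s = F s * resample B i G s"
      by (simp add: resample_def sum_distrib_left)
  qed
  have rG: "resample B i (\<lambda>s. F s * G s) = (\<lambda>s. resample B i F s * G s)" if "i \<notin> Y"
  proof
    fix s
    have "G (s(i := v)) = G s" for v using that by (intro depends_onD[OF insert.prems(2)]) auto
    then show "resample B i (\<lambda>s. F s * G s) s = resample B i F s * G s"
      by (simp add: resample_def sum_distrib_right)
  qed
  have "i \<notin> X \<or> i \<notin> Y" using assms(2) by blast
  then show ?case
  proof
    assume i: "i \<notin> X"
    show ?thesis
      using insert.IH[OF insert.prems(1) depends_on_resample[OF insert.prems(2)]]
      by (simp add: product_mean_insert insert.hyps rF[OF i] resample_ignored[OF insert.prems(1) i])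
  next
    assume i: "i \<notin> Y"
    show ?thesis
      using insert.IH[OF depends_on_resample[OF insert.prems(1)] insert.prems(2)]
      by (simp add: product_mean_insert insert.hyps rG[OF i] resample_ignored[OF insert.prems(2) i])
  qed
qed

lemma product_mean_const: "finite I \<Longrightarrow> product_mean B I (\<lambda>_. c) = c"
  using card_B_nonzero by (simp add: product_mean_def card_PiE)

lemma product_mean_cong:
  "(\<And>s. s \<in> PiE I (\<lambda>_. B) \<Longrightarrow> F s = G s) \<Longrightarrow> product_mean B I F = product_mean B I G"
  by (simp add: product_mean_def cong: sum.cong)

lemma product_mean_sum:
  "product_mean B I (\<lambda>s. \<Sum>w\<in>W. F w s) = (\<Sum>w\<in>W. product_mean B I (F w))"
  by (simp add: product_mean_def sum.swap[of _ W] sum_divide_distrib)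

lemma product_mean_mult_left: "product_mean B I (\<lambda>s. c * F s) = c * product_mean B I F"
  by (simp add: product_mean_def sum_distrib_left)

end

lemma depends_on_cyclic_prod: "depends_on (set w) (\<lambda>s. cyclic_prod H (map s w))"
  unfolding depends_on_def by (auto cong: map_cong)

text \<open>Count the exits from a fibre of \<open>s\<close>: all occurrences of the letter if the fibre is a
single letter, and at least one otherwise.\<close>
lemma cyclic_changes_lower_bound:
  assumes red: "cyclically_reduced w" and two: "card (s ` set w) \<ge> 2"
  shows "3 * card (s ` set w) \<le> 
    card {t. t < length w \<and> s (w ! t) \<noteq> s (w ! (Suc t mod length w))} + card (set w)"
proof -
  let ?L = "length w"
  define D where "D c = {t. t < ?L \<and> s (w ! t) = c \<and> s (w ! (Suc t mod ?L)) \<noteq> c}" for c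
  define X where "X c = {x \<in> set w. s x = c}" for c
  have Lpos: "?L > 0" using two by (cases w) auto
  have finD: "finite (D c)" for c unfolding D_def by simp
  have "{t. t < ?L \<and> s (w ! t) \<noteq> s (w ! (Suc t mod ?L))} = (\<Union>c\<in>s ` set w. D c)"
    unfolding D_def by (auto; metis nth_mem)
  moreover have "card (\<Union>c\<in>s ` set w. D c) = (\<Sum>c\<in>s ` set w. card (D c))"
    by (intro card_UN_disjoint) (auto simp: D_def)
  ultimately have cD: "card {t. t < ?L \<and> s (w ! t) \<noteq> s (w ! (Suc t mod ?L))}
      = (\<Sum>c\<in>s ` set w. card (D c))" by (rule ssubst)
  have "set w = (\<Union>c\<in>s ` set w. X c)" unfolding X_def by auto
  then have "card (set w) = card (\<Union>c\<in>s ` set w. X c)" by (rule arg_cong)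
  also have "\<dots> = (\<Sum>c\<in>s ` set w. card (X c))"
    by (intro card_UN_disjoint) (auto simp: X_def)
  finally have cX: "card (set w) = (\<Sum>c\<in>s ` set w. card (X c))" .
  \<comment> \<open>A fibre with one letter contributes \<open>2 + 1\<close>: the letter occurs
    twice, each time followed by another letter. A larger fibre contributes at least
    \<open>1 + 2\<close>.\<close>
  have each: "3 \<le> card (D c) + card (X c)" if c: "c \<in> s ` set w" for c
  proof -
    obtain x where x: "x \<in> set w" "s x = c" using c by blast
    then obtain t where t: "t < ?L" "w ! t = x" by (auto simp: in_set_conv_nth)
    have fX: "finite (X c)" "x \<in> X c" using x unfolding X_def by auto
    show ?thesis
    proof (cases "card (X c) \<ge> 2")
      case True
      \<comment> \<open>Without an exit the value \<open>c\<close> would spread round the whole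
        cycle, although \<open>s\<close> takes two values.\<close>
      have "D c \<noteq> {}"
      proof
        assume "D c = {}"
        then have step: "s (w ! (Suc j mod ?L)) = c" if "j < ?L" "s (w ! j) = c" for j
          using that unfolding D_def by blast
        have all: "s (w ! ((t + j) mod ?L)) = c" for j
        proof (induction j)
          case 0
          then show ?case using t x by simp
        next
          case (Suc j)
          then have "s (w ! (Suc ((t + j) mod ?L) mod ?L)) = c" using Lpos by (intro step) auto
          then show ?case by (simp add: mod_Suc_eq)
        qed
        have "s y = c" if "y \<in> set w" for y
        proof -
          obtain j where j: "j < ?L" "w ! j = y" using \<open>y \<in> set w\<close> by (auto simp: in_set_conv_nth)
          have "(t + (?L - t + j)) mod ?L = j" using t j by simp
          then show ?thesis using all[of "?L - t + j"] j by simp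
        qed
        then have "s ` set w \<subseteq> {c}" by blast
        then show False using two card_mono[of "{c}" "s ` set w"] by simp
      qed
      then have "card (D c) \<ge> 1" using finD card_0_eq[of "D c"] by (metis One_nat_def Suc_leI neq0_conv)
      then show ?thesis using True by simp
    next
      case False
      moreover have "card (X c) \<noteq> 0" using fX by auto
      ultimately have c1: "card (X c) = 1" by simp
      then have Xc: "X c = {x}" using fX by (metis card_1_singletonE singletonD)
      obtain t' where t': "t' < ?L" "t' \<noteq> t" "w ! t' = x"
        using red t unfolding cyclically_reduced_def by metis
      have "j \<in> D c" if j: "j < ?L" "w ! j = x" for j
      proof -
        have "w ! (Suc j mod ?L) \<noteq> x" using red j unfolding cyclically_reduced_def by metis
        moreover have "w ! (Suc j mod ?L) \<in> set w" using Lpos by simp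
        ultimately have "s (w ! (Suc j mod ?L)) \<noteq> c" using Xc unfolding X_def by blast
        then show ?thesis using j x unfolding D_def by simp
      qed
      then have "{t, t'} \<subseteq> D c" using t t' by blast
      then have "card (D c) \<ge> 2" using card_mono[OF finD, of "{t, t'}" c] t' by simp
      then show ?thesis using c1 by simp
    qed
  qed
  have "3 * card (s ` set w) = (\<Sum>c\<in>s ` set w. 3)" by simp
  also have "\<dots> \<le> (\<Sum>c\<in>s ` set w. card (D c) + card (X c))" by (intro sum_mono each)
  finally show ?thesis using cD cX by (simp add: sum.distrib)
qed

section \<open>Mean values of closed walks\<close>

text \<open>These are the properties of the union of bases on which the estimates rest. With
  \<open>m n\<close> vectors, \<open>card_B_ge\<close> expresses that \<open>m\<close> is at least
  \<open>sqrt n\<close>, and \<open>H_tight\<close> is Parseval's identity summed over the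
  \<open>m\<close> bases.\<close>

locale frame_kernel =
  fixes B :: "'b set" and H :: "'b \<Rightarrow> 'b \<Rightarrow> complex" and n :: real
  assumes finite_B: "finite B"
    and n_ge_1: "1 \<le> n"
    and card_B_ge: "n * sqrt n \<le> card B"
    and H_refl: "x \<in> B \<Longrightarrow> H x x = 1"
    and H_le: "x \<in> B \<Longrightarrow> y \<in> B \<Longrightarrow> x \<noteq> y \<Longrightarrow> cmod (H x y) \<le> 1 / sqrt n"
    and H_cnj: "H y x = cnj (H x y)"
    and H_tight: "x \<in> B \<Longrightarrow> y \<in> B \<Longrightarrow> (\<Sum>v\<in>B. H x v * H v y) = of_nat (card B) / of_real n * H x y"
begin

abbreviation walk_mean :: "'a set \<Rightarrow> 'a list \<Rightarrow> complex" where
  "walk_mean I w \<equiv> product_mean B I (\<lambda>s. cyclic_prod H (map s w))"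

text \<open>Divided by \<open>n^2\<close> this is \<open>1 / n^2 + 1 / card B\<close>, the error to
  be reached when \<open>card B = m n\<close>.\<close>

definition err :: real where "err = 1 + n\<^sup>2 / card B"

lemma n_le_card: "n \<le> card B"
proof -
  have "n * 1 \<le> n * sqrt n" using n_ge_1 by (intro mult_left_mono) auto
  then show ?thesis using card_B_ge by simp
qed

lemma card_B_pos: "0 < card B"
  using n_le_card n_ge_1 by (cases "card B") auto

lemma B_nonempty: "B \<noteq> {}"
  using card_B_pos by auto

lemma err_ge_1: "1 \<le> err"
  unfolding err_def by simp

text \<open>This crude bound allows one factor in a product of two errors to be exchanged for
  \<open>n\<close>, the size of a main term.\<close>

lemma err_le: "err \<le> 2 * n"
proof -
  have "n\<^sup>2 / card B \<le> n\<^sup>2 / n" using n_le_card n_ge_1 by (intro divide_left_mono) auto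
  also have "\<dots> = n" by (simp add: power2_eq_square)
  finally show ?thesis unfolding err_def using n_ge_1 by simp
qed

lemma cmod_cyclic_prod_le:
  assumes "set xs \<subseteq> B"
  shows "cmod (cyclic_prod H xs)
    \<le> (1 / sqrt n) ^ card {t. t < length xs \<and> xs ! t \<noteq> xs ! (Suc t mod length xs)}"
proof -
  let ?next = "\<lambda>t. xs ! (Suc t mod length xs)"
  have "cmod (cyclic_prod H xs) = (\<Prod>t<length xs. cmod (H (xs ! t) (?next t)))"
    by (simp add: cyclic_prod_nth prod_norm)
  also have "\<dots> \<le> (\<Prod>t<length xs. if xs ! t \<noteq> ?next t then 1 / sqrt n else 1)"
  proof (intro prod_mono conjI)
    fix t assume "t \<in> {..<length xs}"
    then have "t < length xs" "Suc t mod length xs < length xs" by (auto intro: mod_less_divisor)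
    then have "xs ! t \<in> B" "?next t \<in> B" using assms nth_mem by blast+
    then show "cmod (H (xs ! t) (?next t)) \<le> (if xs ! t \<noteq> ?next t then 1 / sqrt n else 1)"
      using H_refl H_le by auto
  qed simp
  also have "\<dots> = (1 / sqrt n) ^ card {t. t < length xs \<and> xs ! t \<noteq> ?next t}"
    by (simp only: prod.If_cases finite_lessThan prod_constant power_one mult_1_right)
       (simp add: Int_def)
  finally show ?thesis .
qed

section \<open>Walk means under rotation and the two reductions\<close>

lemma walk_mean_rotate: "walk_mean I (rotate k w) = walk_mean I w"
  by (simp add: rotate_map[symmetric] cyclic_prod_rotate)

lemma walk_mean_adjacent:
  assumes "x \<in> I"
  shows "walk_mean I (x # x # u) = walk_mean I (x # u)"
proof (rule product_mean_cong[OF finite_B B_nonempty])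
  fix s assume "s \<in> PiE I (\<lambda>_. B)"
  then have "H (s x) (s x) = 1" using assms by (intro H_refl) auto
  then show "cyclic_prod H (map s (x # x # u)) = cyclic_prod H (map s (x # u))"
    by (simp add: cyclic_prod_Cons path_prod_Cons)
qed

text \<open>The value at \<open>x\<close> enters only the two factors next to it; summing over that
  value contracts them by \<open>H_tight\<close>, and normalising by \<open>card B\<close> leaves
  \<open>1 / n\<close>. If \<open>u\<close> has a single letter, both neighbours of \<open>x\<close>
  are that same letter.\<close>

lemma walk_mean_singleton:
  assumes "finite I" "x \<in> I" "set u \<subseteq> I" "x \<notin> set u" "u \<noteq> []"
  shows "walk_mean I (x # u) = walk_mean I u / of_real n"
proof -
  let ?J = "I - {x}"
  have I: "I = insert x ?J" "finite ?J" "x \<notin> ?J" using assms by auto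
  obtain y u' where u: "u = y # u'" using assms by (cases u) auto
  have dep: "depends_on (set u) (\<lambda>s. cyclic_prod H (map s u))" by (rule depends_on_cyclic_prod)
  have "walk_mean I (x # u) = product_mean B ?J (resample B x (\<lambda>s. cyclic_prod H (map s (x # u))))"
    using product_mean_insert[OF finite_B B_nonempty I(2,3)] I(1) by metis
  also have "\<dots> = product_mean B ?J (\<lambda>s. (1 / of_real n) * cyclic_prod H (map s u))"
  proof (rule product_mean_cong[OF finite_B B_nonempty])
    fix s assume s: "s \<in> PiE ?J (\<lambda>_. B)"
    have sB: "s z \<in> B" if "z \<in> set u" for z
      using s that assms(3,4) by (auto simp: PiE_def Pi_def)
    obtain v z where uv: "u = v @ [z]" using assms(5) by (metis rev_exhaust)
    have "z \<in> set u" unfolding uv by simp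
    moreover have "y \<in> set u" unfolding u by simp
    ultimately have zy: "s z \<in> B" "s y \<in> B" using sB by auto
    have eq: "cyclic_prod H (map (s(x := b)) (x # u)) = path_prod H (s y) (map s u') b * H b (s y)" for b
    proof -
      have "map (s(x := b)) (x # u) = b # map s u" using assms(4) by simp
      then show ?thesis unfolding u by (simp only: list.map cyclic_prod_Cons path_prod_Cons mult.commute)
    qed
    have "(\<Sum>b\<in>B. path_prod H (s y) (map s u') b * H b (s y))
        = of_nat (card B) / of_real n * path_prod H (s y) (map s u') (s y)"
    proof (cases u' rule: rev_cases)
      case Nil
      then show ?thesis using H_tight[of "s y" "s y"] zy by simp
    next
      case (snoc v' z')
      then have "z' = z" using u uv by simp
      have "(\<Sum>b\<in>B. path_prod H (s y) (map s u') b * H b (s y))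
         = path_prod H (s y) (map s v') (s z) * (\<Sum>b\<in>B. H (s z) b * H b (s y))"
        using snoc \<open>z' = z\<close> by (simp add: path_prod_append sum_distrib_left mult.assoc)
      also have "\<dots> = path_prod H (s y) (map s v') (s z) * (of_nat (card B) / of_real n * H (s z) (s y))"
        using H_tight zy by simp
      finally show ?thesis using snoc \<open>z' = z\<close> by (simp add: path_prod_append)
    qed
    then show "resample B x (\<lambda>s. cyclic_prod H (map s (x # u))) s = 1 / of_real n * cyclic_prod H (map s u)"
      unfolding resample_def eq using card_B_pos u by (simp add: cyclic_prod_Cons)
  qed
  also have "\<dots> = (1 / of_real n) * walk_mean ?J u"
    by (rule product_mean_mult_left[OF finite_B B_nonempty])
  also have "walk_mean ?J u = walk_mean I u"
    using assms
    by (subst (1 2) product_mean_marginal[OF finite_B B_nonempty _ _ dep]) auto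
  finally show ?thesis by simp
qed

text \<open>The exponent of \<open>card B\<close> is chosen so that, after multiplication by the
  \<open>O(N^k)\<close> assignments with \<open>k\<close> values and division by \<open>N^V\<close>,
  every \<open>k\<close> contributes \<open>O(err)\<close>.\<close>

lemma cyclically_reduced_pointwise:
  assumes red: "cyclically_reduced w" and s: "s \<in> PiE (set w) (\<lambda>_. B)" and V2: "card (set w) \<ge> 2"
  shows "n ^ card (set w) * cmod (cyclic_prod H (map s w))
    \<le> real (card B) ^ (card (set w) - card (s ` set w)) * err"
proof -
  let ?V = "card (set w)" and ?N = "real (card B)" and ?r = "sqrt n"
  let ?k = "card (s ` set w)"
  define e where "e = card {t. t < length w \<and> s (w ! t) \<noteq> s (w ! (Suc t mod length w))}"
  have "w \<noteq> []" using V2 by auto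
  have r: "1 \<le> ?r" "?r ^ 2 = n" using n_ge_1 by auto
  have kV: "?k \<le> ?V" by (simp add: card_image_le)
  have "cmod (cyclic_prod H (map s w))
     \<le> (1 / ?r) ^ card {t. t < length (map s w) \<and> map s w ! t \<noteq> map s w ! (Suc t mod length (map s w))}"
    using s by (intro cmod_cyclic_prod_le) auto
  also have "{t. t < length (map s w) \<and> map s w ! t \<noteq> map s w ! (Suc t mod length (map s w))}
     = {t. t < length w \<and> s (w ! t) \<noteq> s (w ! (Suc t mod length w))}"
    using \<open>w \<noteq> []\<close> by auto
  finally have bound: "cmod (cyclic_prod H (map s w)) \<le> (1 / ?r) ^ e" unfolding e_def .
  have "?k \<noteq> 0" using \<open>w \<noteq> []\<close> by simp
  then consider "?k = 1" | "?k \<ge> 2" by linarith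
  then show ?thesis
  proof cases
    case 1
    \<comment> \<open>For a constant assignment no factor decays. Of the \<open>V\<close> factors
      \<open>n\<close>, all but two are bounded by \<open>N\<close>; the remaining
      \<open>n^2\<close> is the source of \<open>n^2 / N\<close> in \<open>err\<close>.\<close>
    have "(1 / ?r) ^ e \<le> 1" using r(1) by (intro power_le_one) auto
    then have "n ^ ?V * cmod (cyclic_prod H (map s w)) \<le> n ^ ?V * 1"
      using bound n_ge_1 by (intro mult_left_mono) auto
    also have "\<dots> = n ^ ((?V - 2) + 2)" using V2 by (simp only: le_add_diff_inverse2 mult_1_right)
    also have "\<dots> = n ^ (?V - 2) * n\<^sup>2" by (rule power_add)
    also have "\<dots> \<le> ?N ^ (?V - 2) * n\<^sup>2"
      using n_ge_1 n_le_card by (intro mult_right_mono power_mono) auto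
    also have "\<dots> = ?N ^ (?V - 1) * (n\<^sup>2 / ?N)"
    proof -
      have "?V - 1 = Suc (?V - 2)" using V2 by simp
      then show ?thesis using card_B_pos by simp
    qed
    also have "\<dots> \<le> ?N ^ (?V - 1) * err" unfolding err_def by (intro mult_left_mono) auto
    finally show ?thesis using 1 by simp
  next
    case 2
    have ineq: "3 * ?k \<le> e + ?V" using cyclic_changes_lower_bound[OF red 2] unfolding e_def .
    have N3: "?r ^ 3 \<le> ?N" using card_B_ge r(2) by (simp add: power3_eq_cube power2_eq_square)
    have "n ^ ?V = ?r ^ (2 * ?V)" using r(2) by (metis power_mult)
    \<comment> \<open>The lower bound on the number of changes, rearranged: \<open>2 V\<close> is at
      most \<open>3 (V - k) + e\<close>. The powers of \<open>?r ^ 3\<close> are then bounded by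
      powers of \<open>N\<close>.\<close>
    also have "\<dots> \<le> ?r ^ (3 * (?V - ?k) + e)"
      using r(1) ineq kV by (intro power_increasing) auto
    also have "\<dots> = (?r ^ 3) ^ (?V - ?k) * ?r ^ e" by (simp add: power_add power_mult)
    also have "\<dots> \<le> ?N ^ (?V - ?k) * ?r ^ e"
      using N3 r(1) by (intro mult_right_mono power_mono) auto
    finally have *: "n ^ ?V \<le> ?N ^ (?V - ?k) * ?r ^ e" .
    have "n ^ ?V * cmod (cyclic_prod H (map s w)) \<le> (?N ^ (?V - ?k) * ?r ^ e) * (1 / ?r) ^ e"
      using * bound n_ge_1 by (intro mult_mono) auto
    also have "\<dots> = ?N ^ (?V - ?k)" using r(1) by (simp add: power_divide)
    also have "\<dots> \<le> ?N ^ (?V - ?k) * err"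
      using err_ge_1 by (simp add: mult_le_cancel_left1)
    finally show ?thesis .
  qed
qed

lemma walk_mean_cyclically_reduced:
  assumes red: "cyclically_reduced w" and "length w \<ge> 2" "finite I" "set w \<subseteq> I"
  shows "n ^ card (set w) * cmod (walk_mean I w) \<le> real (card (set w) ^ Suc (card (set w))) * err"
proof -
  let ?X = "set w" and ?V = "card (set w)" and ?N = "real (card B)"
  let ?P = "PiE ?X (\<lambda>_. B)" and ?T = "\<lambda>s. cmod (cyclic_prod H (map s w))"
  have N: "?N > 0" using card_B_pos by simp
  have V2: "?V \<ge> 2"
  proof -
    have "w ! 0 \<noteq> w ! 1" using red assms(2) unfolding cyclically_reduced_def
      by (metis One_nat_def Suc_1 Suc_le_lessD less_Suc_eq_0_disj mod_less Suc_lessD)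
    then have "card {w ! 0, w ! 1} = 2" by simp
    moreover have "{w ! 0, w ! 1} \<subseteq> set w" using assms(2) nth_mem[of 0 w] nth_mem[of 1 w] by fastforce
    ultimately show ?thesis by (metis List.finite_set card_mono)
  qed
  have finP: "finite ?P" using finite_B by (intro finite_PiE) auto
  have "cmod (walk_mean I w) = cmod (walk_mean ?X w)"
    using product_mean_marginal[OF finite_B B_nonempty assms(3,4) depends_on_cyclic_prod] by metis
  also have "\<dots> \<le> (\<Sum>s\<in>?P. ?T s) / ?N ^ ?V"
    unfolding product_mean_def by (simp add: norm_divide norm_power divide_right_mono norm_sum)
  finally have "n ^ ?V * cmod (walk_mean I w) \<le> n ^ ?V * ((\<Sum>s\<in>?P. ?T s) / ?N ^ ?V)"
    using n_ge_1 by (intro mult_left_mono) auto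
  also have "\<dots> = (\<Sum>s\<in>?P. n ^ ?V * ?T s) / ?N ^ ?V" by (simp add: sum_distrib_left)
  also have "(\<Sum>s\<in>?P. n ^ ?V * ?T s) \<le> (\<Sum>s\<in>?P. ?N ^ (?V - card (s ` ?X)) * err)"
    by (intro sum_mono cyclically_reduced_pointwise red V2) auto
  \<comment> \<open>Sorted by the number of values there are \<open>V\<close> classes, each
    contributing at most \<open>V^V N^V err\<close>; this explains the exponent \<open>Suc V\<close>
    in the constant.\<close>
  also have "\<dots> = (\<Sum>k\<in>{1..?V}. \<Sum>s\<in>{s\<in>?P. card (s ` ?X) = k}. ?N ^ (?V - card (s ` ?X)) * err)"
  proof (rule sum.group[symmetric])
    have "1 \<le> card (s ` ?X)" for s :: "'a \<Rightarrow> 'b"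
      using V2 by (cases "card (s ` ?X)") auto
    then show "(\<lambda>s. card (s ` ?X)) ` ?P \<subseteq> {1..?V}"
      using card_image_le[of ?X] by auto
  qed (use finP in auto)
  also have "\<dots> = (\<Sum>k\<in>{1..?V}. real (card {s\<in>?P. card (s ` ?X) = k}) * (?N ^ (?V - k) * err))"
    by (intro sum.cong) auto
  also have "\<dots> \<le> (\<Sum>k\<in>{1..?V}. (real ?V ^ ?V * ?N ^ k) * (?N ^ (?V - k) * err))"
  proof (intro sum_mono mult_right_mono)
    fix k assume k: "k \<in> {1..?V}"
    have "real (card {s\<in>?P. card (s ` ?X) = k}) \<le> real (k ^ ?V * card B ^ k)"
      using card_PiE_few_values[OF finite_B, of ?X k] by (simp only: of_nat_le_iff) simp
    also have "\<dots> \<le> real ?V ^ ?V * ?N ^ k"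
      using k by (simp add: mult_right_mono power_mono)
    finally show "real (card {s\<in>?P. card (s ` ?X) = k}) \<le> real ?V ^ ?V * ?N ^ k" .
  qed (use err_ge_1 in auto)
  also have "\<dots> = (\<Sum>k\<in>{1..?V}. real ?V ^ ?V * ?N ^ ?V * err)"
    by (intro sum.cong) (auto simp flip: power_add)
  also have "\<dots> = real (?V ^ Suc ?V) * err * ?N ^ ?V" by simp
  finally show ?thesis using N by (simp add: divide_right_mono pos_divide_le_eq)
qed

text \<open>Both reductions keep crossing and the normalised mean: merging leaves the number of
  letters unchanged, while removing a singleton lowers it by one and costs \<open>1 / n\<close>.
  They are exact, so the constant does not grow along the induction. It ends with a single letter,
  whose normalised mean is \<open>n\<close>, or with a reduced word, which is crossing.\<close>

lemma walk_mean_estimate: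
  assumes "finite I" "w \<noteq> []" "set w \<subseteq> I" "length w \<le> L"
  shows "cmod (of_real (n ^ card (set w)) * walk_mean I w - (if crossing w then 0 else of_real n))
    \<le> real (L ^ Suc L) * err"
  using assms(2-)
proof (induction "length w" arbitrary: w rule: less_induct)
  case less
  have pos: "0 \<le> real (L ^ Suc L) * err" using err_ge_1 by simp
  show ?case
  proof (cases "length w = 1")
    case True
    then obtain x where x: "w = [x]" by (auto simp: length_Suc_conv)
    have "walk_mean I w = product_mean B I (\<lambda>_. 1)"
    proof (rule product_mean_cong[OF finite_B B_nonempty])
      fix s assume "s \<in> PiE I (\<lambda>_. B)"
      then show "cyclic_prod H (map s w) = 1"
        using less.prems x by (auto simp: cyclic_prod_Cons intro!: H_refl)
    qed
    then show ?thesis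
      using pos x by (simp add: product_mean_const[OF finite_B B_nonempty assms(1)] not_crossing_Cons_Nil)
  next
    case False
    then have len: "length w \<ge> 2" using less.prems(1) by (cases w; cases "tl w") auto
    show ?thesis
    proof (cases "cyclically_reduced w")
      case True
      have "card (set w) \<le> L" using card_length[of w] less.prems(3) by simp
      then have "card (set w) ^ Suc (card (set w)) \<le> L ^ Suc (card (set w))" by (intro power_mono) auto
      also have "\<dots> \<le> L ^ Suc L" using \<open>card (set w) \<le> L\<close> less.prems len by (intro power_increasing) auto
      finally have "real (card (set w) ^ Suc (card (set w))) * err \<le> real (L ^ Suc L) * err"
        using err_ge_1 by (intro mult_right_mono of_nat_mono) auto
      then show ?thesis
        using walk_mean_cyclically_reduced[OF True len assms(1) less.prems(2)] n_ge_1
          cyclically_reduced_imp_crossing[OF True less.prems(1)]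
        by (simp add: norm_mult norm_power)
    next
      case False
      then show ?thesis using len
      proof (cases rule: not_cyclically_reduced_cases)
        case (adjacent k x u)
        have "set (x # u) = set w" "length (x # u) < length w"
          using set_rotate[of k w] length_rotate[of k w] adjacent by auto
        moreover have "crossing w \<longleftrightarrow> crossing (x # u)"
          using crossing_rotate[of k w] crossing_adjacent[of x u] adjacent by simp
        moreover have "walk_mean I w = walk_mean I (x # u)"
          using walk_mean_rotate[of I k w] walk_mean_adjacent[of x I u] adjacent
            less.prems(2) \<open>set (x # u) = set w\<close> by auto
        ultimately show ?thesis using less.hyps[of "x # u"] less.prems by simp
      next
        case (singleton k x u)
        have sw: "set w = insert x (set u)" and lw: "length w = Suc (length u)"
          using set_rotate[of k w] length_rotate[of k w] singleton by auto
        then have u: "u \<noteq> []" "x \<in> I" "set u \<subseteq> I" using len less.prems by auto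
        have cr: "crossing w \<longleftrightarrow> crossing u"
          using crossing_rotate[of k w] crossing_singleton[of x u] singleton by simp
        have "walk_mean I w = walk_mean I u / of_real n"
          using walk_mean_rotate[of I k w] walk_mean_singleton[OF assms(1) u(2,3) singleton(2) u(1)]
            singleton(1) by simp
        then have "of_real (n ^ card (set w)) * walk_mean I w = of_real (n ^ card (set u)) * walk_mean I u"
          using sw singleton(2) n_ge_1 by simp
        then show ?thesis using less.hyps[of u] lw u less.prems cr by simp
      qed
    qed
  qed
qed

end

section \<open>Covariances of closed walks\<close>

context frame_kernel
begin

abbreviation walk_cov :: "'a set \<Rightarrow> 'a list \<Rightarrow> 'a list \<Rightarrow> complex" where
  "walk_cov I w w' \<equiv>
     product_mean B I (\<lambda>s. cyclic_prod H (map s w) * cyclic_prod H (map s w'))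
       - walk_mean I w * walk_mean I w'"

lemma walk_cov_disjoint:
  assumes "finite I" "set w \<inter> set w' = {}"
  shows "walk_cov I w w' = 0"
  using product_mean_indep[OF finite_B B_nonempty assms(1,2) depends_on_cyclic_prod depends_on_cyclic_prod]
  by simp

text \<open>All factors are equal to 1 here. The general covariance bound would give only
  \<open>err / n\<close> for each of the \<open>p\<close> letters, which is too weak for the factor
  \<open>(p / n)^2\<close> required later.\<close>

lemma walk_cov_one_letter:
  assumes "finite I" "set w \<subseteq> {x}" "set w' \<subseteq> {x}" "x \<in> I"
  shows "walk_cov I w w' = 0"
proof -
  have one: "cyclic_prod H (map s u) = 1" if "s \<in> PiE I (\<lambda>_. B)" "set u \<subseteq> {x}" for s u
  proof -
    have "u ! t = x" if "t < length u" for t using that \<open>set u \<subseteq> {x}\<close> nth_mem by blast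
    moreover have "H (s x) (s x) = 1" using that assms(4) by (intro H_refl) auto
    ultimately show ?thesis
      by (auto simp: cyclic_prod_nth intro!: prod.neutral) (metis mod_less_divisor gr_implies_not0 neq0_conv nth_map)
  qed
  have "product_mean B I (\<lambda>s. cyclic_prod H (map s w) * cyclic_prod H (map s w')) = product_mean B I (\<lambda>_. 1)"
    using one assms by (intro product_mean_cong[OF finite_B B_nonempty]) auto
  moreover have "walk_mean I w = product_mean B I (\<lambda>_. 1)" "walk_mean I w' = product_mean B I (\<lambda>_. 1)"
    using one assms by (auto intro!: product_mean_cong[OF finite_B B_nonempty])
  ultimately show ?thesis by (simp add: product_mean_const[OF finite_B B_nonempty assms(1)])
qed

lemma walk_mean_le:
  assumes "finite I" "w \<noteq> []" "set w \<subseteq> I" "length w \<le> L"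
  shows "cmod (of_real (n ^ card (set w)) * walk_mean I w) \<le> (1 + 2 * real (L ^ Suc L)) * n"
proof -
  let ?C = "real (L ^ Suc L)"
  let ?a = "of_real (n ^ card (set w)) * walk_mean I w"
  let ?d = "if crossing w then 0 else complex_of_real n"
  have "cmod ?a \<le> cmod (?a - ?d) + cmod ?d" by (metis norm_triangle_sub add.commute)
  also have "cmod ?d \<le> n" using n_ge_1 by simp
  also have "cmod (?a - ?d) \<le> ?C * err" by (rule walk_mean_estimate[OF assms])
  also have "?C * err \<le> ?C * (2 * n)" using err_le by (intro mult_left_mono) auto
  finally show ?thesis by (simp add: algebra_simps)
qed

text \<open>Two closed walks through a common letter \<open>v\<close> are read as the single closed walk
\<open>v us v vs\<close>. If \<open>v\<close> is the only common letter, then the main terms of the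
two sides cancel; otherwise the joined walk is crossing.\<close>
lemma walk_cov_join_le:
  fixes us vs :: "'a list"
  assumes I: "finite I" "set (v # us) \<subseteq> I" "set (v # vs) \<subseteq> I"
    and L: "length (v # us) + length (v # vs) \<le> L"
  shows "n ^ card (set (v # us) \<union> set (v # vs)) * cmod (walk_cov I (v # us) (v # vs))
    \<le> (real (L ^ Suc L) + (1 + 2 * real (L ^ Suc L))\<^sup>2) * err"
proof -
  let ?C = "real (L ^ Suc L)"
  let ?X = "set (v # us)" and ?Y = "set (v # vs)"
  let ?E = "walk_mean I (v # us @ v # vs)" and ?E1 = "walk_mean I (v # us)" and ?E2 = "walk_mean I (v # vs)"
  let ?d = "\<lambda>w. if crossing w then 0 else complex_of_real n"
  define a where "a = of_real (n ^ card ?X) * ?E1"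
  define b where "b = of_real (n ^ card ?Y) * ?E2"
  define c where "c = of_real (n ^ card (?X \<union> ?Y)) * ?E"
  have n0: "n > 0" using n_ge_1 by simp
  have C0: "?C \<ge> 0" by simp
  have cov: "walk_cov I (v # us) (v # vs) = ?E - ?E1 * ?E2"
    using cyclic_prod_join[of H "s v" "map s us" "map s vs" for s] by simp
  have XY: "set (v # us @ v # vs) = ?X \<union> ?Y" by auto
  have a: "cmod (a - ?d (v # us)) \<le> ?C * err" "cmod a \<le> (1 + 2 * ?C) * n"
    unfolding a_def using I L by (intro walk_mean_estimate walk_mean_le; simp)+
  have b: "cmod (b - ?d (v # vs)) \<le> ?C * err" "cmod b \<le> (1 + 2 * ?C) * n"
    unfolding b_def using I L by (intro walk_mean_estimate walk_mean_le; simp)+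
  have c: "cmod (c - ?d (v # us @ v # vs)) \<le> ?C * err"
    unfolding c_def XY[symmetric] using I L by (intro walk_mean_estimate) simp_all
  have cardXY: "card ?X + card ?Y = card (?X \<union> ?Y) + card (?X \<inter> ?Y)"
    by (rule card_Un_Int) auto
  \<comment> \<open>The product of the two means, scaled by the number of letters of the joined
    walk. The product \<open>a * b\<close> carries the additional scaling
    \<open>n ^ card (?X \<inter> ?Y)\<close>.\<close>
  define z where "z = of_real (n ^ card (?X \<union> ?Y)) * (?E1 * ?E2)"
  have ab: "a * b = of_real (n ^ card (?X \<inter> ?Y)) * z"
  proof -
    have "a * b = of_real (n ^ (card ?X + card ?Y)) * (?E1 * ?E2)"
      unfolding a_def b_def by (simp only: power_add of_real_mult mult_ac)
    then show ?thesis unfolding cardXY z_def by (simp only: power_add of_real_mult mult_ac)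
  qed
  have lhs: "n ^ card (?X \<union> ?Y) * cmod (walk_cov I (v # us) (v # vs))
      = cmod (c - z)"
  proof -
    have "cmod (of_real (n ^ card (?X \<union> ?Y)) * (?E - ?E1 * ?E2)) = n ^ card (?X \<union> ?Y) * cmod (?E - ?E1 * ?E2)"
      using n0 by (simp only: norm_mult norm_of_real abs_of_pos zero_less_power)
    then show ?thesis unfolding cov c_def z_def by (simp only: right_diff_distrib)
  qed
  show ?thesis
  proof (cases "?X \<inter> ?Y = {v}")
    case True
    \<comment> \<open>With \<open>p\<close> and \<open>q\<close> as indicators of noncrossing, the
      main terms are \<open>p n\<close>, \<open>q n\<close> and, for the joined walk,
      \<open>p q n\<close>. The last cancels against \<open>(p n) (q n) / n\<close>.\<close>
    define p where "p = (if crossing (v # us) then 0 else 1 :: complex)"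
    define q where "q = (if crossing (v # vs) then 0 else 1 :: complex)"
    define \<alpha> where "\<alpha> = a - ?d (v # us)"
    define \<beta> where "\<beta> = b - ?d (v # vs)"
    have pq: "?d (v # us @ v # vs) = p * q * n" "a = p * n + \<alpha>" "b = q * n + \<beta>"
      "cmod p \<le> 1" "cmod q \<le> 1"
      using crossing_join_iff[OF True] by (auto simp: p_def q_def \<alpha>_def \<beta>_def)
    have "a * b = of_real n * (z)"
      using ab unfolding True by simp
    then have "z = a * b / n" using n0 by simp
    also have "\<dots> = p * q * n + (p * \<beta> + q * \<alpha> + \<alpha> * \<beta> / n)"
      unfolding pq(2,3) using n0 by (simp add: field_simps)
    finally have eq: "c - z
        = (c - ?d (v # us @ v # vs)) - (p * \<beta> + q * \<alpha> + \<alpha> * \<beta> / n)"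
      unfolding pq(1) by (simp only: diff_diff_eq)
    have "cmod (p * \<beta>) \<le> 1 * (?C * err)" "cmod (q * \<alpha>) \<le> 1 * (?C * err)"
      unfolding norm_mult using a(1) b(1) pq(4,5) by (intro mult_mono; simp add: \<alpha>_def \<beta>_def)+
    \<comment> \<open>In the product of the two errors one factor \<open>err\<close> is bounded by
      \<open>2 n\<close>, which the division by \<open>n\<close> absorbs.\<close>
    moreover have "cmod (\<alpha> * \<beta> / n) \<le> 2 * ?C\<^sup>2 * err"
    proof -
      have "cmod (\<alpha> * \<beta> / n) = cmod \<alpha> * cmod \<beta> / n" using n0 by (simp add: norm_mult norm_divide)
      also have "\<dots> \<le> (?C * err) * (?C * (2 * n)) / n"
        using a(1) b(1) err_le n0 err_ge_1 unfolding \<alpha>_def[symmetric] \<beta>_def[symmetric]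
        by (intro divide_right_mono mult_mono order.trans[OF b(1)[folded \<beta>_def]] mult_left_mono) auto
      also have "\<dots> = 2 * ?C\<^sup>2 * err" using n0 by (simp add: power2_eq_square)
      finally show ?thesis .
    qed
    moreover have "cmod (p * \<beta> + q * \<alpha> + \<alpha> * \<beta> / n) \<le> cmod (p * \<beta>) + cmod (q * \<alpha>) + cmod (\<alpha> * \<beta> / n)"
      by (rule norm_triangle_mono[OF norm_triangle_ineq order_refl, THEN order_trans]) simp
    moreover have "cmod (c - z)
       \<le> cmod (c - ?d (v # us @ v # vs)) + cmod (p * \<beta> + q * \<alpha> + \<alpha> * \<beta> / n)"
      unfolding eq by (rule norm_triangle_ineq4)
    ultimately have "cmod (c - z)
       \<le> ?C * err + (?C * err + ?C * err + 2 * ?C\<^sup>2 * err)"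
      using c by linarith
    also have "\<dots> = (?C + (2 * ?C + 2 * ?C\<^sup>2)) * err" by (simp only: algebra_simps mult_2)
    also have "\<dots> \<le> (?C + (1 + 2 * ?C)\<^sup>2) * err"
    proof (intro mult_right_mono add_left_mono)
      have "2 * x + 2 * x\<^sup>2 \<le> (1 + 2 * x)\<^sup>2" if "x \<ge> 0" for x :: real
        using that zero_le_power2[of x] by (simp add: power2_sum power_mult_distrib)
      then show "2 * ?C + 2 * ?C\<^sup>2 \<le> (1 + 2 * ?C)\<^sup>2" using C0 by blast
    qed (use err_ge_1 in simp)
    finally show ?thesis unfolding lhs .
  next
    case False
    then obtain u where u: "u \<in> ?X \<inter> ?Y" "u \<noteq> v" by auto
    then have cr: "crossing (v # us @ v # vs)" by (intro crossing_join_shared[of u]) auto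
    \<comment> \<open>Two common letters provide a factor \<open>n^2\<close> in the scaling of
      \<open>a * b\<close>, which compensates for two normalised means of size
      \<open>O(n)\<close>.\<close>
    have "{u, v} \<subseteq> ?X \<inter> ?Y" using u by auto
    then have "card {u, v} \<le> card (?X \<inter> ?Y)" by (intro card_mono) auto
    then have "n ^ 2 \<le> n ^ card (?X \<inter> ?Y)" using u n_ge_1 by (intro power_increasing) auto
    then have "n ^ 2 * cmod z \<le> n ^ card (?X \<inter> ?Y) * cmod z" by (intro mult_right_mono) auto
    also have "\<dots> = cmod (a * b)" unfolding ab
      using n0 by (simp only: norm_mult norm_of_real abs_of_pos zero_less_power)
    also have "\<dots> \<le> ((1 + 2 * ?C) * n) * ((1 + 2 * ?C) * n)"
      unfolding norm_mult using a(2) b(2) n0 C0 by (intro mult_mono) auto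
    also have "\<dots> = n ^ 2 * (1 + 2 * ?C)\<^sup>2" by (simp only: power2_eq_square mult_ac)
    finally have "cmod z \<le> (1 + 2 * ?C)\<^sup>2" using n0 by (simp only: mult_le_cancel_left_pos zero_less_power)
    also have "\<dots> \<le> (1 + 2 * ?C)\<^sup>2 * err" using err_ge_1 by (simp only: mult_le_cancel_left1) simp
    finally have z: "cmod z \<le> (1 + 2 * ?C)\<^sup>2 * err" .
    have "cmod (c - z) \<le> cmod c + cmod z" by (rule norm_triangle_ineq4)
    also have "\<dots> \<le> ?C * err + (1 + 2 * ?C)\<^sup>2 * err" using c cr z by (intro add_mono) simp_all
    finally show ?thesis unfolding lhs by (simp only: distrib_right)
  qed
qed

text \<open>Both words are rotated so as to start at a common letter, which reduces to the joined
  walk.\<close>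

lemma walk_cov_le:
  fixes w w' :: "'a list"
  assumes I: "finite I" "set w \<subseteq> I" "set w' \<subseteq> I"
    and L: "length w + length w' \<le> L" and meet: "set w \<inter> set w' \<noteq> {}"
  shows "n ^ card (set w \<union> set w') * cmod (walk_cov I w w')
    \<le> (real (L ^ Suc L) + (1 + 2 * real (L ^ Suc L))\<^sup>2) * err"
proof -
  obtain v where v: "v \<in> set w" "v \<in> set w'" using meet by blast
  have rot: "\<exists>k us. rotate k u = v # us" if "v \<in> set u" for u :: "'a list"
  proof -
    obtain p q where "u = p @ v # q" using \<open>v \<in> set u\<close> by (meson split_list)
    then have "rotate (length p) u = v # (q @ p)" by (simp add: rotate_append)
    then show ?thesis by blast
  qed
  obtain k us where us: "rotate k w = v # us" using rot[OF v(1)] by blast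
  obtain k' vs where vs: "rotate k' w' = v # vs" using rot[OF v(2)] by blast
  have cyc: "cyclic_prod H (map s w) = cyclic_prod H (map s (v # us))"
    "cyclic_prod H (map s w') = cyclic_prod H (map s (v # vs))" for s
    unfolding us[symmetric] vs[symmetric] by (simp_all add: rotate_map[symmetric] cyclic_prod_rotate)
  have sets: "set w = set (v # us)" "set w' = set (v # vs)"
    and lens: "length w = length (v # us)" "length w' = length (v # vs)"
    unfolding us[symmetric] vs[symmetric] by simp_all
  show ?thesis using walk_cov_join_le[of I v us vs L] I L unfolding cyc sets lens by blast
qed

end

section \<open>The variance of the trace\<close>

text \<open>At most \<open>L^L p^k\<close> words have \<open>k\<close> letters, and as
  \<open>p x\<close> is at most 1, every power with \<open>k\<close> at least 2 is bounded by the
  square. With \<open>x = 1 / n\<close> the resulting \<open>p^2\<close> offsets the normalisation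
  of the trace by \<open>p\<close>.\<close>

lemma sum_few_values_le:
  fixes x :: real and p L :: nat
  assumes "0 \<le> x" "real p * x \<le> 1"
  shows "(\<Sum>u\<in>{u. set u \<subseteq> {..<p} \<and> length u = L}. if card (set u) \<ge> 2 then x ^ card (set u) else 0)
    \<le> real (L ^ Suc L) * (real p * x)\<^sup>2"
proof -
  let ?U = "{u. set u \<subseteq> {..<p} \<and> length u = L}"
  let ?f = "\<lambda>k. if k \<ge> 2 then x ^ k else 0"
  have "(\<Sum>u\<in>?U. ?f (card (set u))) = (\<Sum>k\<in>{0..L}. \<Sum>u\<in>{u\<in>?U. card (set u) = k}. ?f (card (set u)))"
    by (rule sum.group[symmetric]) (auto simp: finite_lists_length_eq card_length)
  also have "\<dots> = (\<Sum>k\<in>{0..L}. real (card {u\<in>?U. card (set u) = k}) * ?f k)"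
    by (intro sum.cong) auto
  \<comment> \<open>The term \<open>k = 0\<close> vanishes, so \<open>L\<close> equal bounds remain
    and \<open>L^L\<close> becomes \<open>L ^ Suc L\<close>.\<close>
  also have "\<dots> \<le> (\<Sum>k\<in>{0..L}. if k = 0 then 0 else real L ^ L * (real p * x)\<^sup>2)"
  proof (intro sum_mono)
    fix k assume k: "k \<in> {0..L}"
    have set_eq: "{u\<in>?U. card (set u) = k} = {u. length u = L \<and> set u \<subseteq> {..<p} \<and> card (set u) = k}"
      by auto
    show "real (card {u\<in>?U. card (set u) = k}) * ?f k \<le> (if k = 0 then 0 else real L ^ L * (real p * x)\<^sup>2)"
    proof (cases "k \<ge> 2")
      case True
      have "real (card {u\<in>?U. card (set u) = k}) \<le> real (k ^ L * card {..<p} ^ k)"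
        unfolding set_eq of_nat_le_iff by (rule card_lists_few_values) simp
      then have "real (card {u\<in>?U. card (set u) = k}) * x ^ k \<le> (real k ^ L * real p ^ k) * x ^ k"
        using assms(1) by (intro mult_right_mono) auto
      also have "\<dots> = real k ^ L * (real p * x) ^ k" by (simp add: power_mult_distrib)
      also have "\<dots> \<le> real L ^ L * (real p * x)\<^sup>2"
        using k True assms by (intro mult_mono power_mono power_decreasing) auto
      finally show ?thesis using True by simp
    qed simp
  qed
  also have "\<dots> = real (L ^ Suc L) * (real p * x)\<^sup>2"
  proof -
    have "{0..L} - {0} = {1..L}" by auto
    then show ?thesis by (simp add: sum.remove[of _ 0])
  qed
  finally show ?thesis .
qed

text \<open>The first factor comes from counting words of length \<open>L\<close>, the second is the
  constant in the covariance bound.\<close>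

definition variance_const :: "nat \<Rightarrow> real" where
  "variance_const L = real (L ^ Suc L) * (real (L ^ Suc L) + (1 + 2 * real (L ^ Suc L))\<^sup>2)"

context frame_kernel
begin

text \<open>The variance expands into covariances of \<open>w\<close> with \<open>rev w'\<close>,
  the reversal arising from conjugation. Only pairs with a common letter and at least two letters
  altogether survive, and these are counted through the concatenation \<open>w @ w'\<close>.\<close>

lemma walk_sum_variance_le:
  fixes p l :: nat
  assumes p: "real p \<le> n"
  defines "W \<equiv> {w. set w \<subseteq> {..<p} \<and> length w = l}"
  defines "X \<equiv> \<lambda>s. \<Sum>w\<in>W. cyclic_prod H (map s w)"
  shows "cmod (product_mean B {..<p} (\<lambda>s. X s * cnj (X s))
           - product_mean B {..<p} X * cnj (product_mean B {..<p} X))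
         \<le> variance_const (2 * l) * (real p / n)\<^sup>2 * err"
proof -
  let ?I = "{..<p}" and ?L = "2 * l" and ?x = "1 / n"
  let ?K = "real (?L ^ Suc ?L) + (1 + 2 * real (?L ^ Suc ?L))\<^sup>2"
  let ?g = "\<lambda>u. if card (set u) \<ge> 2 then ?x ^ card (set u) else 0"
  let ?U = "{u. set u \<subseteq> {..<p} \<and> length u = ?L}"
  note pm = finite_B B_nonempty
  have n0: "n > 0" using n_ge_1 by simp
  have cnjT: "cnj (cyclic_prod H (map s w)) = cyclic_prod H (map s (rev w))" for s and w :: "nat list"
    by (simp add: cyclic_prod_cnj[of H, OF H_cnj] rev_map)
  have EX: "product_mean B ?I X = (\<Sum>w\<in>W. walk_mean ?I w)"
    unfolding X_def by (rule product_mean_sum[OF pm])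
  have "cnj (product_mean B ?I X) = (\<Sum>w\<in>W. walk_mean ?I (rev w))"
  proof -
    have "cnj (walk_mean ?I w) = walk_mean ?I (rev w)" for w
      unfolding product_mean_def by (simp only: complex_cnj_divide complex_cnj_power complex_cnj_of_nat cnj_sum cnjT)
    then show ?thesis unfolding EX by (simp only: cnj_sum)
  qed
  then have prod: "product_mean B ?I X * cnj (product_mean B ?I X)
      = (\<Sum>w\<in>W. \<Sum>w'\<in>W. walk_mean ?I w * walk_mean ?I (rev w'))"
    unfolding EX by (simp only: sum_product)
  have "X s * cnj (X s) = (\<Sum>w\<in>W. \<Sum>w'\<in>W. cyclic_prod H (map s w) * cyclic_prod H (map s (rev w')))" for s
    unfolding X_def cnj_sum cnjT by (rule sum_product)
  then have EXX: "product_mean B ?I (\<lambda>s. X s * cnj (X s)) = (\<Sum>w\<in>W. \<Sum>w'\<in>W.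
      product_mean B ?I (\<lambda>s. cyclic_prod H (map s w) * cyclic_prod H (map s (rev w'))))"
    by (simp only: product_mean_sum[OF pm])
  have each: "cmod (walk_cov ?I w (rev w')) \<le> ?K * err * ?g (w @ w')" if w: "w \<in> W" "w' \<in> W" for w w'
  proof -
    have K0: "0 \<le> ?K * err" using err_ge_1 by (intro mult_nonneg_nonneg add_nonneg_nonneg) auto
    show ?thesis
    proof (cases "set w \<inter> set w' = {}")
      case True
      then have "walk_cov ?I w (rev w') = 0" by (intro walk_cov_disjoint) auto
      then show ?thesis using K0 n0 by (simp only:) simp
    next
      case False
      then obtain x where x: "x \<in> set w" "x \<in> set w'" by blast
      show ?thesis
      proof (cases "card (set (w @ w')) \<ge> 2")
        case True
        have "n ^ card (set w \<union> set (rev w')) * cmod (walk_cov ?I w (rev w')) \<le> ?K * err"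
          using w False by (intro walk_cov_le) (auto simp: W_def)
        then have "cmod (walk_cov ?I w (rev w')) \<le> ?K * err / n ^ card (set (w @ w'))"
          using n0 by (simp only: pos_le_divide_eq zero_less_power set_rev set_append mult.commute)
        then show ?thesis using True by (simp add: power_divide)
      next
        case False
        then have "card (set (w @ w')) \<le> Suc 0" by simp
        then have "\<forall>a\<in>set (w @ w'). \<forall>b\<in>set (w @ w'). a = b" by (subst (asm) card_le_Suc0_iff_eq) auto
        then have "set w \<subseteq> {x}" "set (rev w') \<subseteq> {x}" using x by auto
        then have "walk_cov ?I w (rev w') = 0" using x w by (intro walk_cov_one_letter) (auto simp: W_def)
        then show ?thesis using K0 n0 by (simp only:) simp
      qed
    qed
  qed
  have "product_mean B ?I (\<lambda>s. X s * cnj (X s)) - product_mean B ?I X * cnj (product_mean B ?I X)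
      = (\<Sum>w\<in>W. \<Sum>w'\<in>W. walk_cov ?I w (rev w'))"
    unfolding prod EXX by (simp only: sum_subtractf)
  then have "cmod (product_mean B ?I (\<lambda>s. X s * cnj (X s)) - product_mean B ?I X * cnj (product_mean B ?I X))
      \<le> (\<Sum>w\<in>W. \<Sum>w'\<in>W. cmod (walk_cov ?I w (rev w')))"
    by (simp only:) (intro order_trans[OF norm_sum] sum_mono norm_sum)
  also have "\<dots> \<le> (\<Sum>w\<in>W. \<Sum>w'\<in>W. ?K * err * ?g (w @ w'))"
    by (intro sum_mono each)
  also have "\<dots> = ?K * err * (\<Sum>w\<in>W. \<Sum>w'\<in>W. ?g (w @ w'))"
    by (simp only: sum_distrib_left)
  also have "\<dots> \<le> ?K * err * (real (?L ^ Suc ?L) * (real p * ?x)\<^sup>2)"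
  proof (intro mult_left_mono)
    \<comment> \<open>Words of fixed length can be recovered from their concatenation, so the double
      sum is part of a sum of nonnegative terms over words of length \<open>2 l\<close>.\<close>
    have inj: "inj_on (\<lambda>(w, w'). w @ w') (W \<times> W)" by (auto simp: inj_on_def W_def)
    have pairs: "(\<Sum>w\<in>W. \<Sum>w'\<in>W. g (w @ w')) \<le> (\<Sum>u\<in>?U. g u)"
      if "\<And>u. g u \<ge> 0" for g :: "nat list \<Rightarrow> real"
    proof -
      have "(\<Sum>w\<in>W. \<Sum>w'\<in>W. g (w @ w')) = (\<Sum>u\<in>(\<lambda>(w, w'). w @ w') ` (W \<times> W). g u)"
        using sum.reindex[OF inj, of g] by (simp add: sum.cartesian_product comp_def case_prod_unfold)
      also have "\<dots> \<le> (\<Sum>u\<in>?U. g u)"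
        using that by (intro sum_mono2) (auto simp: W_def finite_lists_length_eq)
      finally show ?thesis .
    qed
    have "(\<Sum>w\<in>W. \<Sum>w'\<in>W. ?g (w @ w')) \<le> (\<Sum>u\<in>?U. ?g u)"
      by (rule pairs[of ?g]) (use n0 in simp)
    also have "\<dots> \<le> real (?L ^ Suc ?L) * (real p * ?x)\<^sup>2"
      using n0 p by (intro sum_few_values_le) auto
    finally show "(\<Sum>w\<in>W. \<Sum>w'\<in>W. ?g (w @ w')) \<le> real (?L ^ Suc ?L) * (real p * ?x)\<^sup>2" .
    show "0 \<le> ?K * err" using err_ge_1 by (intro mult_nonneg_nonneg add_nonneg_nonneg) auto
  qed
  also have "\<dots> = variance_const ?L * (real p / n)\<^sup>2 * err"
    unfolding variance_const_def by (simp only: mult_ac times_divide_eq_right mult_1_right mult_1_left)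
  finally show ?thesis .
qed

end

section \<open>Mutually unbiased bases as a frame kernel\<close>

lemma unitary_columns:
  assumes ortho: "\<And>k k'. k < n \<Longrightarrow> k' < n \<Longrightarrow> herm_inner n (c k) (c k') = (if k = k' then 1 else 0)"
    and "i < n" "j < n"
  shows "(\<Sum>k<n. cnj (c k i) * c k j) = (if i = j then 1 else 0)"
proof -
  define U where "U = mat n n (\<lambda>(k, j). c k j)"
  define U' where "U' = mat n n (\<lambda>(j, k). cnj (c k j))"
  have car: "U \<in> carrier_mat n n" "U' \<in> carrier_mat n n" by (auto simp: U_def U'_def)
  have "U * U' = 1\<^sub>m n"
    by (rule eq_matI)
       (auto simp: U_def U'_def scalar_prod_def ortho[unfolded herm_inner_def] atLeast0LessThan)
  \<comment> \<open>A right inverse of a square matrix is also a left inverse; orthonormality of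
    \<open>n\<close> vectors thus yields completeness.\<close>
  then have "U' * U = 1\<^sub>m n" by (rule mat_mult_left_right_inverse[OF car])
  then have "(U' * U) $$ (i, j) = (if i = j then 1 else 0)" using assms by simp
  moreover have "(U' * U) $$ (i, j) = (\<Sum>k<n. cnj (c k i) * c k j)"
    using assms by (auto simp: U_def U'_def scalar_prod_def atLeast0LessThan)
  ultimately show ?thesis by simp
qed

lemma parseval_herm_inner:
  assumes ortho: "\<And>k k'. k < n \<Longrightarrow> k' < n \<Longrightarrow> herm_inner n (c k) (c k') = (if k = k' then 1 else 0)"
  shows "(\<Sum>k<n. herm_inner n x (c k) * herm_inner n (c k) y) = herm_inner n x y"
proof -
  have "(\<Sum>k<n. herm_inner n x (c k) * herm_inner n (c k) y)
      = (\<Sum>k<n. \<Sum>i<n. \<Sum>j<n. x i * cnj (y j) * (cnj (c k i) * c k j))"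
    unfolding herm_inner_def sum_product by (simp add: mult_ac)
  also have "\<dots> = (\<Sum>i<n. \<Sum>j<n. \<Sum>k<n. x i * cnj (y j) * (cnj (c k i) * c k j))"
    by (subst sum.swap, rule sum.cong[OF refl], rule sum.swap)
  also have "\<dots> = (\<Sum>i<n. \<Sum>j<n. x i * cnj (y j) * (if i = j then 1 else 0))"
    by (intro sum.cong refl) (simp add: unitary_columns[OF ortho] flip: sum_distrib_left)
  also have "\<dots> = herm_inner n x y" unfolding herm_inner_def by (simp add: if_distrib cong: if_cong)
  finally show ?thesis .
qed

definition basis_kernel ::
  "nat \<Rightarrow> (nat \<Rightarrow> nat \<Rightarrow> nat \<Rightarrow> complex) \<Rightarrow> nat \<times> nat \<Rightarrow> nat \<times> nat \<Rightarrow> complex" where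
  "basis_kernel n b x y = herm_inner n (b (fst x) (snd x)) (b (fst y) (snd y))"

lemma frame_kernel_mutually_unbiased:
  assumes "n \<ge> 2" "real m \<ge> sqrt (real n)" "mutually_unbiased n m b"
  shows "frame_kernel (frakB n m) (basis_kernel n b) (real n)"
proof
  have ortho: "herm_inner n (b i k) (b i k') = (if k = k' then 1 else 0)"
    if "i < m" "k < n" "k' < n" for i k k'
    using assms(3) that unfolding mutually_unbiased_def orthonormal_bases_def by blast
  have unb: "cmod (herm_inner n (b i k) (b j k')) = 1 / sqrt n"
    if "i < m" "j < m" "i \<noteq> j" "k < n" "k' < n" for i j k k'
    using assms(3) that unfolding mutually_unbiased_def by blast
  show "finite (frakB n m)" by (simp add: frakB_def)
  show "1 \<le> real n" using assms by simp
  have "real n * sqrt (real n) \<le> real n * real m" using assms by (intro mult_left_mono) auto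
  then show "real n * sqrt (real n) \<le> real (card (frakB n m))"
    by (simp add: frakB_def card_cartesian_product mult.commute)
  show "basis_kernel n b x x = 1" if "x \<in> frakB n m" for x
    using that ortho by (auto simp: frakB_def basis_kernel_def)
  show "cmod (basis_kernel n b x y) \<le> 1 / sqrt (real n)"
    if "x \<in> frakB n m" "y \<in> frakB n m" "x \<noteq> y" for x y
  proof (cases "fst x = fst y")
    case True
    then have "snd x \<noteq> snd y" using that by (auto simp: prod_eq_iff)
    then have "basis_kernel n b x y = 0"
      using that ortho[of "fst x" "snd x" "snd y"] True by (auto simp: frakB_def basis_kernel_def)
    then show ?thesis by simp
  next
    case False
    then show ?thesis using that unb by (auto simp: frakB_def basis_kernel_def)
  qed
  show "basis_kernel n b y x = cnj (basis_kernel n b x y)" for x y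
    by (simp add: basis_kernel_def herm_inner_def mult.commute)
  show "(\<Sum>v\<in>frakB n m. basis_kernel n b x v * basis_kernel n b v y)
      = of_nat (card (frakB n m)) / complex_of_real (real n) * basis_kernel n b x y" for x y
  proof -
    \<comment> \<open>Parseval's identity in each basis reproduces the kernel; the \<open>m\<close>
      copies account for \<open>card B / n\<close>.\<close>
    have "(\<Sum>v\<in>frakB n m. basis_kernel n b x v * basis_kernel n b v y)
      = (\<Sum>i<m. \<Sum>k<n. herm_inner n (b (fst x) (snd x)) (b i k) * herm_inner n (b i k) (b (fst y) (snd y)))"
      unfolding frakB_def basis_kernel_def sum.cartesian_product by (simp add: case_prod_unfold)
    also have "\<dots> = (\<Sum>i<m. basis_kernel n b x y)"
      unfolding basis_kernel_def by (intro sum.cong refl parseval_herm_inner ortho) auto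
    finally show ?thesis using assms by (simp add: frakB_def card_cartesian_product)
  qed
qed

section \<open>Traces of matrix powers as sums over closed walks\<close>

lemma pow_mat_path_sum:
  assumes "i < p" "j < p"
  shows "(mat p p (\<lambda>(i, j). F i j) ^\<^sub>m Suc k) $$ (i, j)
    = (\<Sum>w\<in>{w. set w \<subseteq> {..<p} \<and> length w = k}. path_prod F i w j)"
  using assms(2)
proof (induction k arbitrary: j)
  case 0
  have "{w. set w \<subseteq> {..<p} \<and> length w = 0} = {[]}" by auto
  then show ?case using assms 0 by simp
next
  case (Suc k)
  let ?G = "mat p p (\<lambda>(i, j). F i j)"
  let ?W = "{w. set w \<subseteq> {..<p} \<and> length w = k}"
  have car: "?G ^\<^sub>m Suc k \<in> carrier_mat p p" by (rule pow_carrier_mat) simp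
  \<comment> \<open>The recursion for matrix powers multiplies on the right, so the word of interior
    vertices grows at its end.\<close>
  have inj: "inj_on (\<lambda>(w, z). w @ [z]) (?W \<times> {..<p})" by (auto simp: inj_on_def)
  have img: "{w. set w \<subseteq> {..<p} \<and> length w = Suc k} = (\<lambda>(w, z). w @ [z]) ` (?W \<times> {..<p})"
    by (auto simp: length_Suc_conv_rev image_iff)
  have "(?G ^\<^sub>m Suc (Suc k)) $$ (i, j) = (?G ^\<^sub>m Suc k * ?G) $$ (i, j)" by simp
  also have "\<dots> = (\<Sum>z<p. (?G ^\<^sub>m Suc k) $$ (i, z) * ?G $$ (z, j))"
    using car assms Suc.prems by (subst index_mult_mat) (auto simp: scalar_prod_def atLeast0LessThan simp del: pow_mat.simps)
  also have "\<dots> = (\<Sum>z<p. \<Sum>w\<in>?W. path_prod F i w z * F z j)"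
    using Suc by (intro sum.cong refl) (simp add: sum_distrib_right del: pow_mat.simps)
  also have "\<dots> = (\<Sum>w\<in>?W. \<Sum>z<p. path_prod F i (w @ [z]) j)"
    by (subst sum.swap) (simp add: path_prod_append)
  also have "\<dots> = (\<Sum>w\<in>{w. set w \<subseteq> {..<p} \<and> length w = Suc k}. path_prod F i w j)"
    unfolding img using sum.reindex[OF inj, of "\<lambda>w. path_prod F i w j"]
    by (simp add: sum.cartesian_product comp_def case_prod_unfold)
  finally show ?case .
qed

lemma trace_pow_mat_cyclic_sum:
  assumes "l > 0"
  shows "mat_trace (mat p p (\<lambda>(i, j). F i j) ^\<^sub>m l)
    = (\<Sum>w\<in>{w. set w \<subseteq> {..<p} \<and> length w = l}. cyclic_prod F w)"
proof -
  obtain k where l: "l = Suc k" using assms by (cases l) auto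
  let ?W = "{w. set w \<subseteq> {..<p} \<and> length w = k}"
  have inj: "inj_on (\<lambda>(w, z). z # w) (?W \<times> {..<p})" by (auto simp: inj_on_def)
  have img: "{w. set w \<subseteq> {..<p} \<and> length w = Suc k} = (\<lambda>(w, z). z # w) ` (?W \<times> {..<p})"
    by (rule lists_length_Suc_eq)
  have "mat p p (\<lambda>(i, j). F i j) ^\<^sub>m l \<in> carrier_mat p p" by (rule pow_carrier_mat) simp
  then have "mat_trace (mat p p (\<lambda>(i, j). F i j) ^\<^sub>m l) = (\<Sum>i<p. \<Sum>w\<in>?W. path_prod F i w i)"
    unfolding mat_trace_def l by (simp add: pow_mat_path_sum del: pow_mat.simps)
  also have "\<dots> = (\<Sum>w\<in>?W. \<Sum>i<p. cyclic_prod F (i # w))"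
    by (subst sum.swap) (simp add: cyclic_prod_Cons)
  also have "\<dots> = (\<Sum>w\<in>{w. set w \<subseteq> {..<p} \<and> length w = l}. cyclic_prod F w)"
    unfolding l img using sum.reindex[OF inj, of "cyclic_prod F"]
    by (simp add: sum.cartesian_product comp_def case_prod_unfold)
  finally show ?thesis .
qed

lemma A_l_eq_walk_sum:
  assumes "l > 0"
  shows "A_l n b p l s
    = (\<Sum>w\<in>{w. set w \<subseteq> {..<p} \<and> length w = l}. cyclic_prod (basis_kernel n b) (map s w)) / of_nat p"
proof -
  have "gram n b p s = mat p p (\<lambda>(i, j). basis_kernel n b (s i) (s j))"
    unfolding gram_def basis_kernel_def by (simp add: case_prod_unfold)
  moreover have "cyclic_prod (\<lambda>i j. basis_kernel n b (s i) (s j)) w = cyclic_prod (basis_kernel n b) (map s w)"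
    for w :: "nat list"
    by (simp add: cyclic_prod_def rotate1_map zip_map_map case_prod_unfold comp_def)
  ultimately show ?thesis
    unfolding A_l_def by (simp add: trace_pow_mat_cyclic_sum[OF assms])
qed

text \<open>Writing the squared modulus as \<open>X s * cnj (X s)\<close> makes the variance
  accessible to the algebra of walks. For an upper bound the real part may be replaced by the
  modulus.\<close>

lemma unif_var_divide:
  "unif_var \<Omega> (\<lambda>s. X s / c) \<le> cmod (unif_expect \<Omega> (\<lambda>s. X s * cnj (X s))
     - unif_expect \<Omega> X * cnj (unif_expect \<Omega> X)) / (cmod c)\<^sup>2"
proof -
  let ?Q = "complex_of_real ((cmod c)\<^sup>2)"
  have "unif_expect \<Omega> (\<lambda>s. of_real ((cmod (X s / c))\<^sup>2)) = unif_expect \<Omega> (\<lambda>s. X s * cnj (X s)) / ?Q"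
    unfolding unif_expect_def
    by (simp add: norm_divide power_divide sum_divide_distrib mult.commute flip: complex_norm_square)
  moreover have "complex_of_real ((cmod (unif_expect \<Omega> (\<lambda>s. X s / c)))\<^sup>2)
      = unif_expect \<Omega> X * cnj (unif_expect \<Omega> X) / ?Q"
  proof -
    have "unif_expect \<Omega> (\<lambda>s. X s / c) = unif_expect \<Omega> X / c"
      unfolding unif_expect_def by (simp flip: sum_divide_distrib)
    then show ?thesis by (simp add: norm_divide power_divide flip: complex_norm_square)
  qed
  ultimately have "complex_of_real (unif_var \<Omega> (\<lambda>s. X s / c))
      = complex_of_real (Re (unif_expect \<Omega> (\<lambda>s. X s * cnj (X s)) / ?Q))
        - unif_expect \<Omega> X * cnj (unif_expect \<Omega> X) / ?Q"
    unfolding unif_var_def by simp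
  then have "unif_var \<Omega> (\<lambda>s. X s / c) = Re ((unif_expect \<Omega> (\<lambda>s. X s * cnj (X s))
     - unif_expect \<Omega> X * cnj (unif_expect \<Omega> X)) / ?Q)"
    by (metis (no_types, lifting) Re_complex_of_real diff_divide_distrib minus_complex.simps(1))
  also have "\<dots> \<le> cmod ((unif_expect \<Omega> (\<lambda>s. X s * cnj (X s))
     - unif_expect \<Omega> X * cnj (unif_expect \<Omega> X)) / ?Q)" by (rule complex_Re_le_cmod)
  finally show ?thesis by (simp add: norm_divide norm_power)
qed

theorem theorem3:
  fixes l :: nat
  assumes "l > 0"
  shows "\<exists>C::real. \<forall>n m p (b :: nat \<Rightarrow> nat \<Rightarrow> nat \<Rightarrow> complex).
           n \<ge> 2 \<longrightarrow> m \<ge> 2 \<longrightarrow> real m \<ge> sqrt (real n) \<longrightarrow>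
           mutually_unbiased n m b \<longrightarrow> p > 0 \<longrightarrow> p < n \<longrightarrow>
           unif_var (Omega n m p) (A_l n b p l) \<le> C * (1 / (real m * real n) + 1 / (real n)\<^sup>2)"
proof (intro exI allI impI)
  fix n m p :: nat and b :: "nat \<Rightarrow> nat \<Rightarrow> nat \<Rightarrow> complex"
  assume hyps: "n \<ge> 2" "m \<ge> 2" "real m \<ge> sqrt (real n)" "mutually_unbiased n m b" "p > 0" "p < n"
  interpret frame_kernel "frakB n m" "basis_kernel n b" "real n"
    by (rule frame_kernel_mutually_unbiased) (use hyps in auto)
  let ?X = "\<lambda>s. \<Sum>w\<in>{w. set w \<subseteq> {..<p} \<and> length w = l}. cyclic_prod (basis_kernel n b) (map s w)"
  have expect: "unif_expect (Omega n m p) F = product_mean (frakB n m) {..<p} F" for F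
    unfolding unif_expect_def product_mean_def Omega_def by (simp add: card_PiE)
  have "A_l n b p l = (\<lambda>s. ?X s / of_nat p)"
    using A_l_eq_walk_sum[OF assms] by blast
  then have "unif_var (Omega n m p) (A_l n b p l)
      \<le> cmod (product_mean (frakB n m) {..<p} (\<lambda>s. ?X s * cnj (?X s))
          - product_mean (frakB n m) {..<p} ?X * cnj (product_mean (frakB n m) {..<p} ?X)) / (real p)\<^sup>2"
    using unif_var_divide[of "Omega n m p" ?X "of_nat p"] unfolding expect by simp
  also have "\<dots> \<le> (variance_const (2 * l) * (real p / real n)\<^sup>2 * err) / (real p)\<^sup>2"
    using hyps by (intro divide_right_mono walk_sum_variance_le) auto
  \<comment> \<open>The factor \<open>p^2\<close> from the word count cancels the normalisation of
    the trace; \<open>card B = m n\<close> then turns \<open>err / n^2\<close> into the required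
    sum.\<close>
  also have "\<dots> = variance_const (2 * l) * (err / (real n)\<^sup>2)"
    using hyps by (simp add: power_divide)
  also have "err / (real n)\<^sup>2 = 1 / (real m * real n) + 1 / (real n)\<^sup>2"
    unfolding err_def using hyps
    by (simp add: frakB_def card_cartesian_product add_divide_distrib)
  finally show "unif_var (Omega n m p) (A_l n b p l)
      \<le> variance_const (2 * l) * (1 / (real m * real n) + 1 / (real n)\<^sup>2)" .
qed

end
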